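(* Let $G$ be a CAT(0) group acting geometrically on two proper CAT(0) spaces $X_1$ and $X_2$. Then the corresponding schmear fibers, i.e. the point preimages of the schmear maps $\phi_i:\Lambda\to\partial X_i$ ($i=1,2$), are connected.
   Context: A group acts geometrically on a proper CAT(0) space if it acts properly and cocompactly by isometries; a CAT(0) group is a group admitting such an action. $\partial X$ denotes the visual boundary with the cone topology. Schmear and schmear maps. Give $X_1\times X_2$ the $l_2$-metric (a proper CAT(0) space) and fix a basepoint $(x_1,x_2)$. A ray from $(x_1,x_2)$ has a slope in $[0,\infty]$ (the ratio of the speed of its $X_2$-projection to that of its $X_1$-projection) and projects to rays in $X_1$ and $X_2$ (one of them constant if the slope is $0$ or $\infty$); this identifies $\partial(X_1\times X_2)$ with the join $\partial X_1*\partial X_2=\partial X_1\times\partial X_2\times[0,\infty]/\sim$. The preferred copy of $\partial X_1$ is the set of slope-$0$ points and that of $\partial X_2$ the set of slope-$\infty$ points. Let $G^\Delta=\{(g,g):g\in G\}$ act on $X_1\times X_2$. The schmear $\Lambda$ is the set of limit points in $\partial(X_1\times X_2)$ of the orbit $G^\Delta(x_1,x_2)$. It is known that $\Lambda$ is closed and misses both preferred copies, so $\Lambda\subset\partial X_1\times\partial X_2\times(0,\infty)$; the schmear maps $\phi_i:\Lambda\to\partial X_i$ are the restrictions of the coordinate projections. *)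

theory Defs
  imports "HOL-Analysis.Analysis" "HOL-Algebra.Group_Action"
begin

text \<open>Metric spaces are types of class \<open>metric_space\<close>. The distance on a product type is the
  \<open>l\<^sub>2\<close>-metric, and the class \<open>heine_borel\<close> (bounded sequences have convergent subsequences,
  equivalently closed balls are compact) consists of the proper metric spaces.\<close>

definition geodesic_path :: "(real \<Rightarrow> 'a::metric_space) \<Rightarrow> 'a \<Rightarrow> 'a \<Rightarrow> bool" where
  "geodesic_path c x y \<longleftrightarrow> c 0 = x \<and> c (dist x y) = y \<and>
     (\<forall>s\<in>{0..dist x y}. \<forall>t\<in>{0..dist x y}. dist (c s) (c t) = \<bar>s - t\<bar>)"

text \<open>In the comparison inequality below, \<open>p\<close> and \<open>q\<close> lie on the two sides issuing from the vertex
  \<open>x\<close>. As \<open>x\<close> is an arbitrary vertex, this covers points on any two sides of the triangle.\<close>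

definition CAT0 :: "'a::metric_space itself \<Rightarrow> bool" where
  "CAT0 (T :: 'a itself) \<longleftrightarrow>
     (\<forall>x y :: 'a. \<exists>c. geodesic_path c x y) \<and>
     (\<forall>(x::'a) y z c d p q (x'::real^2) y' z' p' q'.
        geodesic_path c x y \<and> p \<in> c ` {0..dist x y} \<and>
        geodesic_path d x z \<and> q \<in> d ` {0..dist x z} \<and>
        dist x' y' = dist x y \<and> dist y' z' = dist y z \<and> dist x' z' = dist x z \<and>
        p' \<in> closed_segment x' y' \<and> dist x' p' = dist x p \<and>
        q' \<in> closed_segment x' z' \<and> dist x' q' = dist x q
        \<longrightarrow> dist p q \<le> dist p' q')"

definition geometric_action ::
  "('g, 'm) monoid_scheme \<Rightarrow> ('g \<Rightarrow> 'a::metric_space \<Rightarrow> 'a) \<Rightarrow> bool" where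
  "geometric_action G \<alpha> \<longleftrightarrow>
     group_action G UNIV \<alpha> \<and>
     (\<forall>g\<in>carrier G. \<forall>x y. dist (\<alpha> g x) (\<alpha> g y) = dist x y) \<and>
     (\<forall>x. \<exists>r>0. finite {g \<in> carrier G. \<alpha> g ` ball x r \<inter> ball x r \<noteq> {}}) \<and>
     (\<exists>K. compact K \<and> (\<Union>g\<in>carrier G. \<alpha> g ` K) = UNIV)"

text \<open>Only the values of a ray on \<open>{0..}\<close> matter. An asymptoty class contains all total functions
  extending one of its rays, so the values at negative arguments do not affect boundary points.\<close>

definition geodesic_ray :: "(real \<Rightarrow> 'a::metric_space) \<Rightarrow> bool" where
  "geodesic_ray c \<longleftrightarrow> (\<forall>s\<ge>0. \<forall>t\<ge>0. dist (c s) (c t) = \<bar>s - t\<bar>)"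

definition asymptotic_rel :: "((real \<Rightarrow> 'a::metric_space) \<times> (real \<Rightarrow> 'a)) set" where
  "asymptotic_rel = {(c, d). geodesic_ray c \<and> geodesic_ray d \<and>
     (\<exists>K. \<forall>t\<ge>0. dist (c t) (d t) \<le> K)}"

definition visual_boundary :: "(real \<Rightarrow> 'a::metric_space) set set" where
  "visual_boundary = {c. geodesic_ray c} // asymptotic_rel"

text \<open>The cone topology on the disjoint union of \<open>X\<close> (left summand) and its boundary (right
  summand). A basic neighbourhood of the endpoint of a ray \<open>c\<close> from \<open>x\<^sub>0\<close> consists of the points
  outside the closed ball of radius \<open>r\<close> about \<open>x\<^sub>0\<close> whose geodesic (or ray) from \<open>x\<^sub>0\<close> is at time
  \<open>r\<close> within distance \<open>e\<close> of \<open>c r\<close>. In a complete CAT(0) space that geodesic or ray is unique up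
  to values outside its domain, and the resulting topology does not depend on \<open>x\<^sub>0\<close>.\<close>

definition cone_nbhd ::
  "'a::metric_space \<Rightarrow> (real \<Rightarrow> 'a) \<Rightarrow> real \<Rightarrow> real \<Rightarrow> ('a + (real \<Rightarrow> 'a) set) set" where
  "cone_nbhd x0 c r e =
     Inl ` {x. r < dist x0 x \<and> (\<exists>\<gamma>. geodesic_path \<gamma> x0 x \<and> dist (\<gamma> r) (c r) < e)} \<union>
     Inr ` {\<xi> \<in> visual_boundary. \<exists>\<gamma>\<in>\<xi>. \<gamma> 0 = x0 \<and> dist (\<gamma> r) (c r) < e}"

definition cone_topology :: "'a::metric_space \<Rightarrow> ('a + (real \<Rightarrow> 'a) set) topology" where
  "cone_topology x0 = topology_generated_by
     ({Inl ` U |U. open U} \<union>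
      {cone_nbhd x0 c r e |c r e. geodesic_ray c \<and> c 0 = x0 \<and> 0 < r \<and> 0 < e})"

definition boundary_topology :: "'a::metric_space \<Rightarrow> (real \<Rightarrow> 'a) set topology" where
  "boundary_topology x0 = pullback_topology visual_boundary Inr (cone_topology x0)"

definition boundary_limit_points :: "'a::metric_space \<Rightarrow> 'a set \<Rightarrow> (real \<Rightarrow> 'a) set set" where
  "boundary_limit_points x0 A =
     {\<xi> \<in> visual_boundary. Inr \<xi> \<in> cone_topology x0 derived_set_of (Inl ` A)}"

definition schmear ::
  "('g, 'm) monoid_scheme \<Rightarrow> ('g \<Rightarrow> 'a \<Rightarrow> 'a) \<Rightarrow> ('g \<Rightarrow> 'b \<Rightarrow> 'b) \<Rightarrow>
     'a::metric_space \<Rightarrow> 'b::metric_space \<Rightarrow> (real \<Rightarrow> 'a \<times> 'b) set set" where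
  "schmear G \<alpha>1 \<alpha>2 x1 x2 =
     boundary_limit_points (x1, x2) (orbit G (\<lambda>g. map_prod (\<alpha>1 g) (\<alpha>2 g)) (x1, x2))"

text \<open>Join coordinates of a boundary point of the product lying in neither preferred copy: its
  ray from \<open>(x1, x2)\<close> projects to nonconstant rays with endpoints \<open>\<eta>1\<close> and \<open>\<eta>2\<close>, traversed at the
  positive speeds \<open>a\<close> and \<open>b\<close>, and \<open>m = b / a\<close> is its slope.\<close>

definition join_coords ::
  "'a::metric_space \<Rightarrow> 'b::metric_space \<Rightarrow> (real \<Rightarrow> 'a \<times> 'b) set \<Rightarrow>
     (real \<Rightarrow> 'a) set \<Rightarrow> (real \<Rightarrow> 'b) set \<Rightarrow> real \<Rightarrow> bool" where
  "join_coords x1 x2 \<xi> \<eta>1 \<eta>2 m \<longleftrightarrow>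
     \<xi> \<in> visual_boundary \<and> \<eta>1 \<in> visual_boundary \<and> \<eta>2 \<in> visual_boundary \<and>
     (\<exists>c\<in>\<xi>. \<exists>c1\<in>\<eta>1. \<exists>c2\<in>\<eta>2. \<exists>a>0. \<exists>b>0. c 0 = (x1, x2) \<and> m = b / a \<and>
        (\<forall>t\<ge>0. c t = (c1 (a * t), c2 (b * t))))"

text \<open>Since the schmear misses both preferred copies, its points have unique join coordinates, and
  the coordinate projections are well defined on it.\<close>

definition schmear_map1 ::
  "'a::metric_space \<Rightarrow> 'b::metric_space \<Rightarrow> (real \<Rightarrow> 'a \<times> 'b) set \<Rightarrow> (real \<Rightarrow> 'a) set" where
  "schmear_map1 x1 x2 \<xi> = (THE \<eta>1. \<exists>\<eta>2 m. join_coords x1 x2 \<xi> \<eta>1 \<eta>2 m)"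

definition schmear_map2 ::
  "'a::metric_space \<Rightarrow> 'b::metric_space \<Rightarrow> (real \<Rightarrow> 'a \<times> 'b) set \<Rightarrow> (real \<Rightarrow> 'b) set" where
  "schmear_map2 x1 x2 \<xi> = (THE \<eta>2. \<exists>\<eta>1 m. join_coords x1 x2 \<xi> \<eta>1 \<eta>2 m)"

end

theory Submission
  imports Defs "HOL-Library.Diagonal_Subsequence"
begin

text \<open>The fiber of a schmear map over \<open>\<eta>\<close> is connected because a boundary point has coarsely connected
  neighbourhoods in the space, and coarse connectedness is carried from the factor to the diagonal
  orbit, at whose limit it becomes connectedness.

  In detail, let \<open>\<eta>\<close> be a boundary point of the factor \<open>X1\<close>. Both actions are geometric, so the distances
  \<open>d(x1, g x1)\<close> and \<open>d(x2, g x2)\<close> are linearly bounded by each other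
  (\<open>orbit_map_linear_bound\<close>). If the diagonal orbit points of a sequence \<open>g n\<close> converge to a
  boundary point of the product, the slope of this point is therefore neither \<open>0\<close> nor infinite, and
  along a subsequence the points \<open>g n x1\<close> and \<open>g n x2\<close> converge to its join coordinates
  (\<open>approaches_prod\<close>). Together with compactness of the boundary (\<open>ex_approaching_subsequence\<close>) this
  identifies the fiber over \<open>\<eta>\<close> with the set of limits of diagonal orbit points along sequences
  with \<open>g n x1\<close> converging to \<open>\<eta>\<close>.

  Two sequences of orbit points in \<open>X1\<close> converging to \<open>\<eta>\<close> can be joined by chains with bounded steps
  that also converge to \<open>\<eta>\<close>: go back along the geodesic to the basepoint until it is close to the other
  geodesic, then go out along the latter (\<open>ex_group_chains\<close>). The same group elements give chains with
  bounded steps in the diagonal orbit (\<open>orbit_map_coarse\<close>), whose limits all lie in the fiber. If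
  the fiber were separated by two open sets, these chains would have to cross from one to the other. A
  bounded step does not change the limit, so the crossing points would have a limit in the fiber that can
  lie in neither set (\<open>connectedin_if_chains\<close>).

  The \<open>CAT(0)\<close> inequality enters through a contraction property of the geodesics from the basepoint
  (\<open>conical_basepoint\<close>), which is inherited by products (\<open>conical_prod\<close>).\<close>

section \<open>Geodesics issuing from a basepoint\<close>

text \<open>The argument only ever looks along geodesics issuing from one point, so the \<open>CAT(0)\<close> inequality
  enters through a single consequence: points at the same proportion \<open>l\<close> along two such geodesics
  are at most \<open>l\<close> times as far apart as the endpoints. Phrasing it for points dividing distances in
  proportion \<open>l\<close>, instead of for geodesic paths, includes uniqueness of geodesics from \<open>x0\<close> and
  makes the condition pass to products coordinatewise.\<close>

locale conical_basepoint =
  fixes x0 :: "'a::heine_borel"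
  assumes ex_geodesic: "\<exists>c. geodesic_path c x0 y"
    and contraction: "\<lbrakk>0 \<le> l; l \<le> 1;
      dist x0 p = l * dist x0 y; dist p y = (1 - l) * dist x0 y;
      dist x0 q = l * dist x0 z; dist q z = (1 - l) * dist x0 z\<rbrakk>
      \<Longrightarrow> dist p q \<le> l * dist y z"

text \<open>The concatenation of geodesics to and from a point between \<open>x\<close> and \<open>y\<close> is a geodesic. This brings
  points given by distances alone into the scope of the comparison inequality.\<close>

lemma ex_geodesic_through:
  fixes x y p :: "'a::metric_space"
  assumes "geodesic_path c1 x p" "geodesic_path c2 p y" and on: "dist x p + dist p y = dist x y"
  shows "\<exists>c. geodesic_path c x y \<and> c (dist x p) = p"
proof -
  define a where "a = dist x p"
  define c where "c t = (if t \<le> a then c1 t else c2 (t - a))" for t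
  have c1: "c1 0 = x" "c1 a = p"
    "\<And>s t. 0 \<le> s \<Longrightarrow> s \<le> a \<Longrightarrow> 0 \<le> t \<Longrightarrow> t \<le> a \<Longrightarrow> dist (c1 s) (c1 t) = \<bar>s - t\<bar>"
    and c2: "c2 0 = p" "c2 (dist p y) = y"
    "\<And>s t. 0 \<le> s \<Longrightarrow> s \<le> dist p y \<Longrightarrow> 0 \<le> t \<Longrightarrow> t \<le> dist p y \<Longrightarrow> dist (c2 s) (c2 t) = \<bar>s - t\<bar>"
    using assms(1,2) by (auto simp: geodesic_path_def a_def)
  have a0: "0 \<le> a" and ay: "dist p y = dist x y - a" using on by (auto simp: a_def)
  have mixed: "dist (c1 s) (c2 (t - a)) = t - s"
    if "0 \<le> s" "s \<le> a" "a < t" "t \<le> dist x y" for s t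
  proof -
    have 1: "dist (c1 s) p = a - s" using c1(3)[of s a] c1(2) that a0 by simp
    have 2: "dist p (c2 (t - a)) = t - a" using c2(3)[of 0 "t - a"] c2(1) that ay by simp
    have 3: "dist x (c1 s) = s" using c1(3)[of 0 s] c1(1) that a0 by simp
    have 4: "dist (c2 (t - a)) y = dist x y - t" using c2(3)[of "t - a" "dist p y"] c2(2) that ay by simp
    show ?thesis
      using 1 2 3 4 dist_triangle[of "c1 s" "c2 (t - a)" p] dist_triangle[of x y "c1 s"]
        dist_triangle[of "c1 s" y "c2 (t - a)"] by linarith
  qed
  have "dist (c s) (c t) = \<bar>s - t\<bar>" if "0 \<le> s" "s \<le> dist x y" "0 \<le> t" "t \<le> dist x y" for s t
    using that mixed[of s t] mixed[of t s] c1(3)[of s t] c2(3)[of "s - a" "t - a"] ay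
    by (auto simp: c_def dist_commute)
  moreover have "c (dist x y) = y"
  proof (cases "dist x y \<le> a")
    case True
    then have "dist p y = 0" "dist x y = a" using ay zero_le_dist[of p y] by linarith+
    then show ?thesis using c1 by (simp add: c_def)
  qed (use ay c2 in \<open>simp add: c_def\<close>)
  ultimately show ?thesis using c1 a0 by (intro exI[of _ c]) (auto simp: geodesic_path_def c_def a_def)
qed

lemma ex_comparison_triangle:
  fixes a b d :: real
  assumes "0 \<le> a" "0 \<le> b" "a \<le> b + d" "b \<le> a + d" "d \<le> a + b"
  shows "\<exists>x y z :: real^2. dist x y = a \<and> dist x z = b \<and> dist y z = d"
proof (cases "a = 0")
  case True
  show ?thesis
    by (rule exI[of _ 0], rule exI[of _ 0], rule exI[of _ "b *\<^sub>R axis 1 1"])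
      (use assms True in \<open>auto simp: dist_norm\<close>)
next
  case False
  define u where "u = (a\<^sup>2 + b\<^sup>2 - d\<^sup>2) / (2 * a)"
  define v where "v = sqrt (b\<^sup>2 - u\<^sup>2)"
  have a: "a > 0" using False assms by simp
  have "d \<ge> 0" using assms by linarith
  have ua: "2 * a * u = a\<^sup>2 + b\<^sup>2 - d\<^sup>2" using a by (simp add: u_def)
  have "(a - b)\<^sup>2 \<le> d\<^sup>2" by (rule abs_le_square_iff[THEN iffD1]) (use assms in auto)
  then have "2 * a * u \<le> 2 * a * b" using ua by (simp add: power2_diff)
  then have "u \<le> b" using a by simp
  have "d\<^sup>2 \<le> (a + b)\<^sup>2" by (rule abs_le_square_iff[THEN iffD1]) (use assms \<open>d \<ge> 0\<close> in auto)
  then have "2 * a * (- b) \<le> 2 * a * u" using ua by (simp add: power2_sum)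
  then have "- b \<le> u" by (rule mult_left_le_imp_le) (use a in simp)
  have "u\<^sup>2 \<le> b\<^sup>2" by (rule abs_le_square_iff[THEN iffD1]) (use \<open>u \<le> b\<close> \<open>- b \<le> u\<close> in auto)
  then have v: "v\<^sup>2 = b\<^sup>2 - u\<^sup>2" by (simp add: v_def)
  let ?y = "a *\<^sub>R axis 1 1 :: real^2" and ?z = "u *\<^sub>R axis 1 1 + v *\<^sub>R axis 2 1 :: real^2"
  have "norm ?z ^ 2 = u\<^sup>2 + v\<^sup>2"
    unfolding power2_norm_eq_inner by (simp add: inner_simps inner_axis_axis power2_eq_square)
  then have 1: "norm ?z = b" using v assms by (metis add.commute diff_add_cancel norm_ge_zero power2_eq_iff_nonneg)
  have "norm (?y - ?z) ^ 2 = (a - u)\<^sup>2 + v\<^sup>2"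
    unfolding power2_norm_eq_inner by (simp add: inner_simps inner_axis_axis power2_eq_square algebra_simps)
  also have "\<dots> = d\<^sup>2" using v ua by (simp add: power2_diff algebra_simps)
  finally have 2: "norm (?y - ?z) = d" using \<open>d \<ge> 0\<close> by (metis norm_ge_zero power2_eq_iff_nonneg)
  show ?thesis
    by (rule exI[of _ 0], rule exI[of _ ?y], rule exI[of _ ?z]) (use 1 2 a in \<open>simp add: dist_0_norm dist_norm[of ?y]\<close>)
qed

text \<open>In the Euclidean comparison triangle the corresponding points are the images of the endpoints
  under the dilation with factor \<open>l\<close> about the vertex, so there the inequality is an equality.\<close>

lemma CAT0_imp_conical:
  assumes "CAT0 TYPE('a::heine_borel)"
  shows "conical_basepoint (x0 :: 'a)"
proof
  have geo: "\<exists>c. geodesic_path c x y" for x y :: 'a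
    using assms by (auto simp: CAT0_def)
  show "\<exists>c. geodesic_path c x0 y" for y by (rule geo)
  fix l :: real and p q y z :: 'a
  assume l: "0 \<le> l" "l \<le> 1" and p: "dist x0 p = l * dist x0 y" "dist p y = (1 - l) * dist x0 y"
    and q: "dist x0 q = l * dist x0 z" "dist q z = (1 - l) * dist x0 z"
  have "\<exists>c. geodesic_path c x0 y \<and> c (dist x0 p) = p"
    using geo[of x0 p] geo[of p y] ex_geodesic_through[of _ x0 p _ y] p by (auto simp: algebra_simps)
  then obtain c where c: "geodesic_path c x0 y" "c (dist x0 p) = p" by blast
  have "\<exists>c. geodesic_path c x0 z \<and> c (dist x0 q) = q"
    using geo[of x0 q] geo[of q z] ex_geodesic_through[of _ x0 q _ z] q by (auto simp: algebra_simps)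
  then obtain d where d: "geodesic_path d x0 z" "d (dist x0 q) = q" by blast
  have "\<exists>x' y' z' :: real^2. dist x' y' = dist x0 y \<and> dist x' z' = dist x0 z \<and> dist y' z' = dist y z"
    by (rule ex_comparison_triangle) (auto intro: dist_triangle dist_triangle2 dist_triangle3)
  then obtain x' y' z' :: "real^2" where t: "dist x' y' = dist x0 y" "dist x' z' = dist x0 z" "dist y' z' = dist y z"
    by blast
  define p' q' where "p' = (1 - l) *\<^sub>R x' + l *\<^sub>R y'" and "q' = (1 - l) *\<^sub>R x' + l *\<^sub>R z'"
  have pd: "p' - x' = l *\<^sub>R (y' - x')" "q' - x' = l *\<^sub>R (z' - x')" "p' - q' = l *\<^sub>R (y' - z')"
    by (auto simp: p'_def q'_def algebra_simps)
  have "dist x' p' = l * dist x' y'" "dist x' q' = l * dist x' z'" and pq: "dist p' q' = l * dist y' z'"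
    using l unfolding dist_commute[of x'] by (simp_all add: dist_norm pd)
  then have "dist x' p' = dist x0 p" "dist x' q' = dist x0 q" using p q t by auto
  moreover have "p' \<in> closed_segment x' y'" "q' \<in> closed_segment x' z'"
    using l by (auto simp: p'_def q'_def closed_segment_def)
  moreover have "p \<in> c ` {0..dist x0 y}" "q \<in> d ` {0..dist x0 z}"
    using c(2)[symmetric] d(2)[symmetric] p q l mult_left_le_one_le[of "dist x0 y" l] mult_left_le_one_le[of "dist x0 z" l]
    by (auto intro!: image_eqI)
  ultimately have "dist p q \<le> dist p' q'"
    using assms c(1) d(1) t unfolding CAT0_def by blast
  then show "dist p q \<le> l * dist y z" using pq t by simp
qed

text \<open>A point between \<open>x\<close> and \<open>y\<close> in the product gives equality in the Minkowski inequality for the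
  vectors of coordinate distances. Equality forces these vectors to be parallel, so both coordinates
  divide their distances in the same proportion.\<close>

lemma projections_of_between:
  fixes x y p :: "'a::metric_space \<times> 'b::metric_space"
  assumes l: "0 \<le> l" "l \<le> 1"
    and p: "dist x p = l * dist x y" "dist p y = (1 - l) * dist x y"
  shows "dist (fst x) (fst p) = l * dist (fst x) (fst y)"
    and "dist (fst p) (fst y) = (1 - l) * dist (fst x) (fst y)"
    and "dist (snd x) (snd p) = l * dist (snd x) (snd y)"
    and "dist (snd p) (snd y) = (1 - l) * dist (snd x) (snd y)"
proof -
  define u v w :: "real \<times> real" where
    "u = (dist (fst x) (fst p), dist (snd x) (snd p))" and
    "v = (dist (fst p) (fst y), dist (snd p) (snd y))" and
    "w = (dist (fst x) (fst y), dist (snd x) (snd y))"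
  have nu: "norm u = l * norm w" and nv: "norm v = (1 - l) * norm w"
    using p by (simp_all add: u_def v_def w_def dist_prod_def norm_prod_def)
  have "inner w w \<le> inner w (u + v)"
    unfolding u_def v_def w_def inner_prod_def
    by (auto intro!: add_mono mult_left_mono dist_triangle)
  then have le: "(norm w)\<^sup>2 \<le> inner w u + inner w v"
    by (simp add: inner_add_right power2_norm_eq_inner)
  have 1: "inner w u \<le> l * (norm w)\<^sup>2" "inner w v \<le> (1 - l) * (norm w)\<^sup>2"
    using norm_cauchy_schwarz[of w u] norm_cauchy_schwarz[of w v] nu nv
    by (simp_all add: power2_eq_square algebra_simps)
  have "inner w u = l * (norm w)\<^sup>2" "inner w v = (1 - l) * (norm w)\<^sup>2"
    using 1 le by (simp_all add: algebra_simps)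
  then have "(norm (u - l *\<^sub>R w))\<^sup>2 = 0" "(norm (v - (1 - l) *\<^sub>R w))\<^sup>2 = 0"
    using nu nv unfolding power2_norm_eq_inner inner_diff_left inner_diff_right inner_scaleR_left inner_scaleR_right
    by (simp_all add: power2_norm_eq_inner[symmetric] inner_commute[of _ w] power_mult_distrib)
      (simp_all add: power2_eq_square algebra_simps)
  then have "u = l *\<^sub>R w" "v = (1 - l) *\<^sub>R w" by simp_all
  then show "dist (fst x) (fst p) = l * dist (fst x) (fst y)"
    and "dist (fst p) (fst y) = (1 - l) * dist (fst x) (fst y)"
    and "dist (snd x) (snd p) = l * dist (snd x) (snd y)"
    and "dist (snd p) (snd y) = (1 - l) * dist (snd x) (snd y)"
    by (simp_all add: u_def v_def w_def)
qed

lemma conical_prod: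
  assumes "conical_basepoint (x1 :: 'a::heine_borel)" "conical_basepoint (x2 :: 'b::heine_borel)"
  shows "conical_basepoint (x1, x2)"
proof
  interpret A: conical_basepoint x1 by fact
  interpret B: conical_basepoint x2 by fact
  fix y :: "'a \<times> 'b"
  obtain y1 y2 where y: "y = (y1, y2)" by fastforce
  obtain c1 c2 where c: "geodesic_path c1 x1 y1" "geodesic_path c2 x2 y2"
    using A.ex_geodesic B.ex_geodesic by blast
  define D d1 d2 where "D = dist (x1, x2) y" and "d1 = dist x1 y1" and "d2 = dist x2 y2"
  have D: "D = sqrt (d1\<^sup>2 + d2\<^sup>2)" by (simp add: D_def d1_def d2_def y dist_prod_def)
  have DD: "D\<^sup>2 = d1\<^sup>2 + d2\<^sup>2" by (simp add: D)
  have nn: "0 \<le> d1" "0 \<le> d2" "0 \<le> D" by (auto simp: d1_def d2_def D_def)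
  have dd: "d1 \<le> D" "d2 \<le> D" unfolding D using nn by (auto intro: real_le_rsqrt)
  show "\<exists>c. geodesic_path c (x1, x2) y"
  proof (cases "D = 0")
    case True
    then have "y = (x1, x2)" by (simp add: D_def)
    then show ?thesis by (auto simp: geodesic_path_def intro!: exI[of _ "\<lambda>_. (x1, x2)"])
  next
    case False
    with nn have D0: "D > 0" by simp
    define c where "c t = (c1 (t * (d1 / D)), c2 (t * (d2 / D)))" for t
    have "dist (c s) (c t) = \<bar>s - t\<bar>" if "0 \<le> s" "s \<le> D" "0 \<le> t" "t \<le> D" for s t
    proof -
      have bd: "0 \<le> s * (d / D) \<and> s * (d / D) \<le> d" if "0 \<le> s" "s \<le> D" "0 \<le> d" for s d
      proof -
        have "s / D \<le> 1" using that D0 by simp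
        from mult_right_mono[OF this \<open>0 \<le> d\<close>] show ?thesis using that D0 by simp
      qed
      have 1: "dist (fst (c s)) (fst (c t)) = \<bar>s - t\<bar> * (d1 / D)"
        using c(1) bd[of s d1] bd[of t d1] that nn D0 unfolding c_def geodesic_path_def
        by (simp add: d1_def[symmetric] left_diff_distrib[symmetric] diff_divide_distrib[symmetric] abs_mult)
      have 2: "dist (snd (c s)) (snd (c t)) = \<bar>s - t\<bar> * (d2 / D)"
        using c(2) bd[of s d2] bd[of t d2] that nn D0 unfolding c_def geodesic_path_def
        by (simp add: d2_def[symmetric] left_diff_distrib[symmetric] diff_divide_distrib[symmetric] abs_mult)
      have "(\<bar>s - t\<bar> * (d1 / D))\<^sup>2 + (\<bar>s - t\<bar> * (d2 / D))\<^sup>2 = \<bar>s - t\<bar>\<^sup>2 * ((d1\<^sup>2 + d2\<^sup>2) / D\<^sup>2)"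
        by (simp add: power_mult_distrib power_divide add_divide_distrib algebra_simps)
      also have "\<dots> = \<bar>s - t\<bar>\<^sup>2" using D0 by (simp add: DD[symmetric])
      finally show ?thesis unfolding dist_prod_def 1 2 by simp
    qed
    moreover have "c 0 = (x1, x2)" "c D = y" using c D0 by (auto simp: c_def geodesic_path_def y d1_def d2_def)
    ultimately show ?thesis unfolding geodesic_path_def D_def by (intro exI[of _ c]) auto
  qed
next
  interpret A: conical_basepoint x1 by fact
  interpret B: conical_basepoint x2 by fact
  fix l :: real and p q y z :: "'a \<times> 'b"
  assume l: "0 \<le> l" "l \<le> 1"
    and p: "dist (x1, x2) p = l * dist (x1, x2) y" "dist p y = (1 - l) * dist (x1, x2) y"
    and q: "dist (x1, x2) q = l * dist (x1, x2) z" "dist q z = (1 - l) * dist (x1, x2) z"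
  note P = projections_of_between[OF l p] projections_of_between[OF l q]
  have 1: "dist (fst p) (fst q) \<le> l * dist (fst y) (fst z)"
    using P l by (intro A.contraction) auto
  have 2: "dist (snd p) (snd q) \<le> l * dist (snd y) (snd z)"
    using P l by (intro B.contraction) auto
  have "dist p q \<le> sqrt ((l * dist (fst y) (fst z))\<^sup>2 + (l * dist (snd y) (snd z))\<^sup>2)"
    unfolding dist_prod_def by (intro real_sqrt_le_mono add_mono power_mono 1 2) auto
  also have "\<dots> = l * dist y z"
    using l by (simp add: dist_prod_def power_mult_distrib distrib_left[symmetric] real_sqrt_mult)
  finally show "dist p q \<le> l * dist y z" .
qed

section \<open>Sequences approaching boundary points\<close>

text \<open>The geodesic from \<open>x\<close> to \<open>y\<close> stays at \<open>y\<close> once it has arrived. All points thereby have geodesics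
  defined for all nonnegative times, which can be compared with rays.\<close>

definition geo :: "'a::metric_space \<Rightarrow> 'a \<Rightarrow> real \<Rightarrow> 'a" where
  "geo x y t = (SOME \<gamma>. geodesic_path \<gamma> x y) (min t (dist x y))"

text \<open>Convergence of a sequence in the space to a boundary point in the cone topology, in terms of
  the ray issuing from \<open>x\<close> in that class.\<close>

definition approaches :: "'a::metric_space \<Rightarrow> (nat \<Rightarrow> 'a) \<Rightarrow> (real \<Rightarrow> 'a) set \<Rightarrow> bool" where
  "approaches x p \<xi> \<longleftrightarrow> \<xi> \<in> visual_boundary \<and> filterlim (\<lambda>n. dist x (p n)) at_top sequentially \<and>
     (\<exists>c\<in>\<xi>. c 0 = x \<and> (\<forall>t\<ge>0. (\<lambda>n. geo x (p n) t) \<longlonglongrightarrow> c t))"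

lemma equiv_asymptotic: "equiv {c :: real \<Rightarrow> 'a::metric_space. geodesic_ray c} asymptotic_rel"
proof (rule equivI)
  show "(asymptotic_rel :: ((real \<Rightarrow> 'a) \<times> (real \<Rightarrow> 'a)) set) \<subseteq> {c. geodesic_ray c} \<times> {c. geodesic_ray c}"
    by (auto simp: asymptotic_rel_def)
  show "refl_on {c :: real \<Rightarrow> 'a. geodesic_ray c} asymptotic_rel"
    by (auto simp: refl_on_def asymptotic_rel_def intro!: exI[of _ 0])
  show "sym (asymptotic_rel :: ((real \<Rightarrow> 'a) \<times> (real \<Rightarrow> 'a)) set)"
    by (auto simp: sym_def asymptotic_rel_def dist_commute)
  show "trans (asymptotic_rel :: ((real \<Rightarrow> 'a) \<times> (real \<Rightarrow> 'a)) set)"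
  proof (rule transI)
    fix c d e :: "real \<Rightarrow> 'a"
    assume "(c, d) \<in> asymptotic_rel" "(d, e) \<in> asymptotic_rel"
    then obtain K L where *: "geodesic_ray c" "geodesic_ray e"
      "\<And>t. t \<ge> 0 \<Longrightarrow> dist (c t) (d t) \<le> K" "\<And>t. t \<ge> 0 \<Longrightarrow> dist (d t) (e t) \<le> L"
      by (auto simp: asymptotic_rel_def)
    have "dist (c t) (e t) \<le> K + L" if "t \<ge> 0" for t
      using *(3,4)[OF that] dist_triangle[of "c t" "e t" "d t"] by linarith
    then show "(c, e) \<in> asymptotic_rel" using * by (auto simp: asymptotic_rel_def)
  qed
qed

lemma boundary_class:
  assumes "geodesic_ray c"
  shows "asymptotic_rel `` {c} \<in> visual_boundary" "c \<in> asymptotic_rel `` {c}"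
  using assms equiv_class_self[OF equiv_asymptotic, of c] by (auto simp: visual_boundary_def intro: quotientI)

lemma ray_of_boundary: "\<xi> \<in> visual_boundary \<Longrightarrow> c \<in> \<xi> \<Longrightarrow> geodesic_ray c"
  using in_quotient_imp_subset[OF equiv_asymptotic] unfolding visual_boundary_def by auto

lemma boundary_asymptotic:
  assumes "\<xi> \<in> visual_boundary" "c \<in> \<xi>" "d \<in> \<xi>"
  shows "\<exists>K. \<forall>t\<ge>0. dist (c t) (d t) \<le> K"
proof -
  have "(c, d) \<in> asymptotic_rel"
    using assms in_quotient_imp_in_rel[OF equiv_asymptotic, of \<xi> c d] by (simp add: visual_boundary_def)
  then show ?thesis by (simp add: asymptotic_rel_def)
qed

lemma boundary_eqI:
  assumes "\<xi> \<in> visual_boundary" "\<zeta> \<in> visual_boundary" "c \<in> \<xi>" "d \<in> \<zeta>" "\<And>t. t \<ge> 0 \<Longrightarrow> c t = d t"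
  shows "\<xi> = \<zeta>"
proof -
  have "(c, d) \<in> asymptotic_rel"
    using assms ray_of_boundary by (auto simp: asymptotic_rel_def intro!: exI[of _ 0])
  then show ?thesis
    using quotient_eqI[OF equiv_asymptotic] assms(1-4) by (simp add: visual_boundary_def)
qed

lemma tendsto_if_dist_le:
  assumes "eventually (\<lambda>n. dist (f n) l \<le> b n) F" "(b \<longlongrightarrow> 0) F"
  shows "(f \<longlongrightarrow> l) F"
  by (rule tendsto_dist_iff[THEN iffD2], rule Lim_null_comparison[OF _ assms(2)]) (use assms(1) in simp)

lemma approaches_by_ray:
  assumes "\<xi> \<in> visual_boundary" "c \<in> \<xi>" "c 0 = x" "filterlim (\<lambda>n. dist x (p n)) at_top sequentially"
    and "\<And>t. t \<ge> 0 \<Longrightarrow> (\<lambda>n. geo x (p n) t) \<longlonglongrightarrow> c t"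
  shows "approaches x p \<xi>"
  unfolding approaches_def by (intro conjI bexI[OF _ assms(2)] assms(1,3,4)) (simp add: assms(5))

lemma approaches_subseq:
  assumes "approaches x p \<xi>" "filterlim r sequentially sequentially"
  shows "approaches x (\<lambda>n. p (r n)) \<xi>"
proof -
  obtain c where c: "c \<in> \<xi>" "c 0 = x" "\<And>t. t \<ge> 0 \<Longrightarrow> (\<lambda>n. geo x (p n) t) \<longlonglongrightarrow> c t"
    using assms(1) unfolding approaches_def by blast
  have "filterlim (\<lambda>n. dist x (p (r n))) at_top sequentially"
    using assms(1) by (intro filterlim_compose[OF _ assms(2)]) (simp add: approaches_def)
  moreover have "(\<lambda>n. geo x (p (r n)) t) \<longlonglongrightarrow> c t" if "t \<ge> 0" for t
    by (rule filterlim_compose[OF c(3)[OF that] assms(2)])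
  ultimately show ?thesis
    using assms(1) c(1,2) approaches_by_ray by (auto simp: approaches_def)
qed

context conical_basepoint
begin

lemma geodesic_path_geo: "geodesic_path (\<lambda>t. geo x0 y t) x0 y"
proof -
  have "geodesic_path (SOME \<gamma>. geodesic_path \<gamma> x0 y) x0 y"
    using ex_geodesic by (rule someI_ex)
  then show ?thesis by (auto simp: geodesic_path_def geo_def)
qed

lemma geo_beyond: "t \<ge> dist x0 y \<Longrightarrow> geo x0 y t = y"
  using geodesic_path_geo[of y] by (auto simp: geodesic_path_def geo_def min_def)

lemma geo_0: "geo x0 y 0 = x0"
  using geodesic_path_geo[of y] by (auto simp: geodesic_path_def)

lemma dist_geo_geo: "0 \<le> s \<Longrightarrow> 0 \<le> t \<Longrightarrow>
    dist (geo x0 y s) (geo x0 y t) = \<bar>min s (dist x0 y) - min t (dist x0 y)\<bar>"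
proof -
  assume "0 \<le> s" "0 \<le> t"
  moreover have "geo x0 y (min s (dist x0 y)) = geo x0 y s" for s by (simp add: geo_def)
  moreover have "dist (geo x0 y s) (geo x0 y t) = \<bar>s - t\<bar>" if "s \<in> {0..dist x0 y}" "t \<in> {0..dist x0 y}" for s t
    using geodesic_path_geo[of y] that unfolding geodesic_path_def by blast
  from this[of "min s (dist x0 y)" "min t (dist x0 y)"]
  have "dist (geo x0 y (min s (dist x0 y))) (geo x0 y (min t (dist x0 y))) = \<bar>min s (dist x0 y) - min t (dist x0 y)\<bar>"
    using \<open>0 \<le> s\<close> \<open>0 \<le> t\<close> by simp
  ultimately show ?thesis by simp
qed

lemma dist_geo_geo_le: "0 \<le> s \<Longrightarrow> 0 \<le> t \<Longrightarrow> dist (geo x0 y s) (geo x0 y t) \<le> \<bar>s - t\<bar>"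
  by (simp add: dist_geo_geo min_def)

lemma dist_geo: "0 \<le> t \<Longrightarrow> dist x0 (geo x0 y t) = min t (dist x0 y)"
  using dist_geo_geo[of 0 t y] by (simp add: geo_0)

lemma dist_geo_end: "0 \<le> t \<Longrightarrow> dist (geo x0 y t) y = dist x0 y - min t (dist x0 y)"
  using dist_geo_geo[of t "dist x0 y" y] by (simp add: geo_beyond)

text \<open>The contraction with lengths in place of proportions, and without division, so that it covers
  \<open>T = 0\<close>.\<close>

lemma segments_contract:
  assumes "0 \<le> t" "t \<le> T" "dist x0 y = T" "dist x0 z = T"
    and "dist x0 p = t" "dist p y = T - t" "dist x0 q = t" "dist q z = T - t"
  shows "T * dist p q \<le> t * dist y z"
proof (cases "T = 0")
  case False
  then have T: "T > 0" using assms by linarith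
  have "t / T * T = t" "(1 - t / T) * T = T - t" using T by (simp_all add: left_diff_distrib)
  then have "dist p q \<le> t / T * dist y z"
    using T assms by (intro contraction) simp_all
  then show ?thesis using T by (simp add: field_simps)
qed (use assms in simp)

lemma between_unique:
  assumes "0 \<le> t" "t \<le> dist x0 y" "dist x0 p = t" "dist p y = dist x0 y - t"
  shows "geo x0 y t = p"
proof (cases "dist x0 y = 0")
  case False
  then have "0 < dist x0 y" by simp
  then show ?thesis
    using segments_contract[OF assms(1,2) refl refl assms(3,4), of "geo x0 y t"] assms
    by (simp add: dist_geo dist_geo_end mult_le_0_iff) 
next
  case True
  then have "t = 0" using assms(1,2) by linarith
  moreover from this have "x0 = p" using assms(3) by (metis dist_eq_0_iff)
  ultimately show ?thesis using geo_0[of y] by metis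
qed

lemma geodesic_path_eq_geo:
  assumes "geodesic_path \<gamma> x0 y" "0 \<le> t" "t \<le> dist x0 y"
  shows "\<gamma> t = geo x0 y t"
proof -
  have iso: "\<And>s t. s \<in> {0..dist x0 y} \<Longrightarrow> t \<in> {0..dist x0 y} \<Longrightarrow> dist (\<gamma> s) (\<gamma> t) = \<bar>s - t\<bar>"
    and ends: "\<gamma> 0 = x0" "\<gamma> (dist x0 y) = y"
    using assms(1) unfolding geodesic_path_def by blast+
  have "dist (\<gamma> 0) (\<gamma> t) = \<bar>0 - t\<bar>" "dist (\<gamma> t) (\<gamma> (dist x0 y)) = \<bar>t - dist x0 y\<bar>"
    by (rule iso; use assms in simp)+
  then have "dist x0 (\<gamma> t) = t" "dist (\<gamma> t) y = dist x0 y - t"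
    using assms unfolding ends by simp_all
  then show ?thesis using assms by (intro between_unique[symmetric])
qed

lemma geo_geo:
  assumes "0 \<le> s" "s \<le> t" "t \<le> dist x0 y"
  shows "geo x0 (geo x0 y t) s = geo x0 y s"
  using assms by (intro between_unique) (auto simp: dist_geo dist_geo_geo)

lemma geo_contract:
  assumes "0 \<le> t" "t \<le> T" "T \<le> dist x0 y" "T \<le> dist x0 z"
  shows "T * dist (geo x0 y t) (geo x0 z t) \<le> t * dist (geo x0 y T) (geo x0 z T)"
  using assms by (intro segments_contract) (auto simp: dist_geo dist_geo_geo)

lemma ray_dist_basepoint: "geodesic_ray c \<Longrightarrow> c 0 = x0 \<Longrightarrow> t \<ge> 0 \<Longrightarrow> dist x0 (c t) = t"
  unfolding geodesic_ray_def by (metis abs_of_nonneg dist_commute diff_zero order_refl)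

lemma ray_eq_geo:
  assumes "geodesic_ray c" "c 0 = x0" "0 \<le> t" "t \<le> T"
  shows "geo x0 (c T) t = c t"
  using assms ray_dist_basepoint[OF assms(1,2)]
  by (intro between_unique) (auto simp: geodesic_ray_def)

lemma geo_ray_contract:
  assumes "geodesic_ray c" "c 0 = x0" "0 \<le> t" "t \<le> T" "T \<le> dist x0 y"
  shows "T * dist (geo x0 y t) (c t) \<le> t * dist (geo x0 y T) (c T)"
  using geo_contract[of t T y "c T"] assms by (simp add: ray_dist_basepoint ray_eq_geo)

lemma ray_ray_contract:
  assumes "geodesic_ray c" "c 0 = x0" "geodesic_ray d" "d 0 = x0" "0 \<le> t" "t \<le> T"
  shows "T * dist (c t) (d t) \<le> t * dist (c T) (d T)"
  using geo_contract[of t T "c T" "d T"] assms by (simp add: ray_dist_basepoint ray_eq_geo)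

lemma mono_of_contract:
  fixes t T a b :: real
  assumes "T * a \<le> t * b" "0 \<le> t" "t \<le> T" "0 \<le> b" "t = 0 \<Longrightarrow> a = 0"
  shows "a \<le> b"
proof (cases "T = 0")
  case False
  then have T: "T > 0" using assms by simp
  have "T * a \<le> T * b" using assms(1) mult_right_mono[OF assms(3,4)] by linarith
  then show ?thesis using T by simp
qed (use assms in auto)

lemma geo_mono:
  assumes "0 \<le> t" "t \<le> T" "T \<le> dist x0 y" "T \<le> dist x0 z"
  shows "dist (geo x0 y t) (geo x0 z t) \<le> dist (geo x0 y T) (geo x0 z T)"
  by (rule mono_of_contract[OF geo_contract[OF assms]]) (use assms in \<open>auto simp: geo_0\<close>)

lemma geo_ray_mono:
  assumes "geodesic_ray c" "c 0 = x0" "0 \<le> t" "t \<le> T" "T \<le> dist x0 y"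
  shows "dist (geo x0 y t) (c t) \<le> dist (geo x0 y T) (c T)"
  by (rule mono_of_contract[OF geo_ray_contract[OF assms]]) (use assms in \<open>auto simp: geo_0\<close>)

lemma ray_ray_mono:
  assumes "geodesic_ray c" "c 0 = x0" "geodesic_ray d" "d 0 = x0" "0 \<le> t" "t \<le> T"
  shows "dist (c t) (d t) \<le> dist (c T) (d T)"
  by (rule mono_of_contract[OF ray_ray_contract[OF assms]]) (use assms in auto)

text \<open>Two rays from \<open>x0\<close> in the same class stay within bounded distance, and contraction from a late
  time \<open>T\<close> back to time \<open>t\<close> divides this bound by \<open>T / t\<close>.\<close>

lemma ray_unique:
  assumes "\<xi> \<in> visual_boundary" "c \<in> \<xi>" "d \<in> \<xi>" "c 0 = x0" "d 0 = x0" "0 \<le> t"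
  shows "c t = d t"
proof (rule ccontr)
  assume "c t \<noteq> d t"
  then have pos: "dist (c t) (d t) > 0" by simp
  obtain K where K: "\<And>t. t \<ge> 0 \<Longrightarrow> dist (c t) (d t) \<le> K"
    using boundary_asymptotic[OF assms(1-3)] by blast
  \<comment> \<open>late enough for the contraction to push the bound \<open>K\<close> below \<open>dist (c t) (d t)\<close>\<close>
  define T where "T = max t ((t * K + 1) / dist (c t) (d t))"
  have "T * dist (c t) (d t) \<le> t * dist (c T) (d T)"
    by (rule ray_ray_contract) (use assms ray_of_boundary in \<open>auto simp: T_def\<close>)
  also have "\<dots> \<le> t * K" using K[of T] assms(6) by (intro mult_left_mono) (auto simp: T_def)
  finally have "T * dist (c t) (d t) \<le> t * K" .
  moreover have "t * K + 1 \<le> T * dist (c t) (d t)"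
    using pos by (simp add: T_def pos_divide_le_eq[symmetric])
  ultimately show False by simp
qed

lemma approaches_unique:
  assumes "approaches x0 p \<xi>" "approaches x0 p \<zeta>"
  shows "\<xi> = \<zeta>"
proof -
  obtain c d where "c \<in> \<xi>" "d \<in> \<zeta>" "\<And>t. t \<ge> 0 \<Longrightarrow> (\<lambda>n. geo x0 (p n) t) \<longlonglongrightarrow> c t"
    "\<And>t. t \<ge> 0 \<Longrightarrow> (\<lambda>n. geo x0 (p n) t) \<longlonglongrightarrow> d t"
    using assms unfolding approaches_def by blast
  then show ?thesis
    using assms LIMSEQ_unique boundary_eqI[of \<xi> \<zeta> c d] by (simp add: approaches_def) blast
qed

lemma geodesic_ray_limit:
  assumes "filterlim (\<lambda>n. dist x0 (p n)) at_top sequentially"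
    and "\<And>t. t \<ge> 0 \<Longrightarrow> (\<lambda>n. geo x0 (p n) t) \<longlonglongrightarrow> c t"
  shows "geodesic_ray c" "c 0 = x0"
proof -
  show "geodesic_ray c" unfolding geodesic_ray_def
  proof (intro allI impI)
    fix s t :: real assume st: "0 \<le> s" "0 \<le> t"
    have "(\<lambda>n. dist (geo x0 (p n) s) (geo x0 (p n) t)) \<longlonglongrightarrow> dist (c s) (c t)"
      by (intro tendsto_dist assms st)
    moreover have "eventually (\<lambda>n. dist (geo x0 (p n) s) (geo x0 (p n) t) = \<bar>s - t\<bar>) sequentially"
      using filterlim_at_top[THEN iffD1, OF assms(1), rule_format, of "max s t"]
      by eventually_elim (use st in \<open>auto simp: dist_geo_geo\<close>)
    ultimately show "dist (c s) (c t) = \<bar>s - t\<bar>"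
      by (rule LIMSEQ_unique[OF _ tendsto_eventually])
  qed
  show "c 0 = x0" using assms(2)[of 0] by (simp add: geo_0 LIMSEQ_const_iff)
qed

lemma approachesI:
  assumes "filterlim (\<lambda>n. dist x0 (p n)) at_top sequentially"
    and "\<And>t. t \<ge> 0 \<Longrightarrow> (\<lambda>n. geo x0 (p n) t) \<longlonglongrightarrow> c t"
  shows "approaches x0 p (asymptotic_rel `` {c})"
proof -
  have "geodesic_ray c" "c 0 = x0" using geodesic_ray_limit[of p c] assms by blast+
  then show ?thesis using assms by (intro approaches_by_ray[of _ c] boundary_class)
qed

text \<open>It suffices that the geodesics to the points are within bounded distance of the ray at times
  tending to infinity: contraction makes them arbitrarily close to the ray at every fixed time.\<close>

lemma approaches_criterion:
  assumes "\<xi> \<in> visual_boundary" "c \<in> \<xi>" "c 0 = x0"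
    and rho: "filterlim \<rho> at_top sequentially" and far: "\<And>n. \<rho> n \<le> dist x0 (p n)"
    and close: "\<And>n. dist (geo x0 (p n) (\<rho> n)) (c (\<rho> n)) \<le> K"
  shows "approaches x0 p \<xi>"
proof -
  have "filterlim (\<lambda>n. dist x0 (p n)) at_top sequentially"
    by (rule filterlim_at_top_mono[OF rho]) (use far in auto)
  moreover have "(\<lambda>n. geo x0 (p n) t) \<longlonglongrightarrow> c t" if t: "t \<ge> 0" for t
  proof -
    have "(\<lambda>n. t * K / \<rho> n) \<longlonglongrightarrow> 0"
      by (rule real_tendsto_divide_at_top[OF tendsto_const rho])
    moreover have "eventually (\<lambda>n. dist (geo x0 (p n) t) (c t) \<le> t * K / \<rho> n) sequentially"
      using filterlim_at_top[THEN iffD1, OF rho, rule_format, of "max t 1"]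
    proof eventually_elim
      case (elim n)
      then have r: "t \<le> \<rho> n" "\<rho> n > 0" by auto
      have "\<rho> n * dist (geo x0 (p n) t) (c t) \<le> t * dist (geo x0 (p n) (\<rho> n)) (c (\<rho> n))"
        using assms ray_of_boundary r t by (intro geo_ray_contract) auto
      also have "\<dots> \<le> t * K" using close t by (intro mult_left_mono) auto
      finally show ?case using r by (simp add: field_simps)
    qed
    ultimately show ?thesis by (rule tendsto_if_dist_le[where b = "\<lambda>n. t * K / \<rho> n", rotated])
  qed
  ultimately show ?thesis by (rule approaches_by_ray[OF assms(1-3)])
qed

text \<open>A bounded displacement in the space becomes invisible at infinity. At time \<open>dist x0 (p n) - D\<close>
  neither geodesic has ended and both are within a bounded distance of their endpoints, so the two
  geodesics are boundedly close there, and contraction applies.\<close>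

lemma approaches_bounded_perturbation:
  assumes "approaches x0 p \<xi>" and D: "eventually (\<lambda>n. dist (p n) (q n) \<le> D) sequentially"
  shows "approaches x0 q \<xi>"
proof -
  obtain c where c: "\<xi> \<in> visual_boundary" "filterlim (\<lambda>n. dist x0 (p n)) at_top sequentially" "c \<in> \<xi>" "c 0 = x0"
    "\<And>t. t \<ge> 0 \<Longrightarrow> (\<lambda>n. geo x0 (p n) t) \<longlonglongrightarrow> c t"
    using assms(1) unfolding approaches_def by blast
  have bd: "filterlim (\<lambda>n. dist x0 (p n) - D) at_top sequentially"
    using filterlim_tendsto_add_at_top[OF tendsto_const[of "-D"] c(2)] by simp
  have "eventually (\<lambda>n. dist x0 (p n) - D \<le> dist x0 (q n)) sequentially"
    using D
  proof eventually_elim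
    case (elim n)
    then show ?case using dist_triangle2[of x0 "p n" "q n"] by linarith
  qed
  then have q: "filterlim (\<lambda>n. dist x0 (q n)) at_top sequentially"
    by (rule filterlim_at_top_mono[OF bd])
  have "(\<lambda>n. geo x0 (q n) t) \<longlonglongrightarrow> c t" if t: "t \<ge> 0" for t
  proof -
    define b where "b n = t * (4 * D) / (dist x0 (p n) - D)" for n
    have b: "b \<longlonglongrightarrow> 0"
      unfolding b_def by (rule real_tendsto_divide_at_top[OF tendsto_const bd])
    have "eventually (\<lambda>n. dist (geo x0 (q n) t) (geo x0 (p n) t) \<le> b n) sequentially"
      using filterlim_at_top[THEN iffD1, OF bd, rule_format, of "max t 1"] D
    proof eventually_elim
      case (elim n)
      define T where "T = dist x0 (p n) - D"
      have T: "T \<ge> t" "T \<ge> 1" "D \<ge> 0" and pq: "dist (p n) (q n) \<le> D"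
        using elim zero_le_dist[of "p n" "q n"] by (auto simp: T_def simp del: zero_le_dist)
      have Tp: "T \<le> dist x0 (p n)" using T by (simp add: T_def)
      have Tq: "T \<le> dist x0 (q n)" and qT: "dist x0 (q n) \<le> T + 2 * D"
        using pq dist_triangle[of x0 "p n" "q n"] dist_triangle[of x0 "q n" "p n"]
        by (auto simp: T_def dist_commute)
      have far: "geo x0 (p n) (T + 2 * D) = p n" "geo x0 (q n) (T + 2 * D) = q n"
        using qT T by (auto intro!: geo_beyond simp: T_def)
      have "dist (geo x0 (q n) T) (geo x0 (p n) T) \<le> dist (geo x0 (q n) T) (q n) + dist (q n) (p n) + dist (p n) (geo x0 (p n) T)"
        using dist_triangle[of "geo x0 (q n) T" "geo x0 (p n) T" "q n"]
          dist_triangle[of "q n" "geo x0 (p n) T" "p n"] by linarith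
      also have "\<dots> \<le> 2 * D + D + D"
        using pq T Tp Tq qT by (simp add: dist_geo_end dist_commute[of "p n" "geo _ _ _"] dist_commute[of "q n" "p n"]) (simp add: T_def)
      finally have 1: "dist (geo x0 (q n) T) (geo x0 (p n) T) \<le> 4 * D" by simp
      have "T * dist (geo x0 (q n) t) (geo x0 (p n) t) \<le> t * dist (geo x0 (q n) T) (geo x0 (p n) T)"
        using t T Tp Tq by (intro geo_contract) auto
      also have "\<dots> \<le> t * (4 * D)" using 1 t by (intro mult_left_mono)
      finally show ?case using T unfolding b_def T_def[symmetric] by (simp add: field_simps)
    qed
    then have ev: "eventually (\<lambda>n. dist (geo x0 (q n) t) (c t) \<le> b n + dist (geo x0 (p n) t) (c t)) sequentially"
    proof eventually_elim
      case (elim n)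
      then show ?case using dist_triangle[of "geo x0 (q n) t" "c t" "geo x0 (p n) t"] by linarith
    qed
    have "(\<lambda>n. dist (geo x0 (p n) t) (c t)) \<longlonglongrightarrow> 0"
      using c(5)[OF t] by (rule tendsto_dist_iff[THEN iffD1])
    from tendsto_add[OF b this] have "(\<lambda>n. b n + dist (geo x0 (p n) t) (c t)) \<longlonglongrightarrow> 0" by simp
    from tendsto_if_dist_le[OF ev this] show ?thesis .
  qed
  then show ?thesis by (rule approaches_by_ray[OF c(1,3,4) q])
qed

text \<open>Properness gives a subsequence whose geodesics converge at all integer times, by a diagonal
  argument, and contraction from the next integer time gives convergence at every time.\<close>

lemma ex_approaching_subsequence:
  assumes "filterlim (\<lambda>n. dist x0 (p n)) at_top sequentially"
  shows "\<exists>r \<xi>. strict_mono (r :: nat \<Rightarrow> nat) \<and> approaches x0 (\<lambda>n. p (r n)) \<xi>"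
proof -
  define P where "P k s \<longleftrightarrow> convergent (\<lambda>n. geo x0 (p (s n)) (real k))" for k and s :: "nat \<Rightarrow> nat"
  interpret subseqs P
  proof
    fix k and s :: "nat \<Rightarrow> nat" assume "strict_mono s"
    have "dist x0 (geo x0 (p (s n)) (real k)) \<le> real k" for n by (simp add: dist_geo)
    then have "bounded (range (\<lambda>n. geo x0 (p (s n)) (real k)))"
      unfolding bounded_def by blast
    from bounded_imp_convergent_subsequence[OF this]
    show "\<exists>r'. strict_mono r' \<and> P k (s \<circ> r')"
      unfolding P_def convergent_def by (auto simp: o_def)
  qed
  have P: "P k diagseq" for k
  proof -
    have "P k (diagseq \<circ> ((+) (Suc k)))"
      by (rule diagseq_holds) (auto simp: P_def o_def convergent_def dest: LIMSEQ_subseq_LIMSEQ[unfolded o_def])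
    from iffD1[OF P_def this] have "convergent (\<lambda>n. geo x0 (p (diagseq (n + Suc k))) (real k))"
      by (simp only: o_def add.commute)
    then have "convergent (\<lambda>n. geo x0 (p (diagseq n)) (real k))"
      by (rule convergent_ignore_initial_segment[THEN iffD1])
    then show ?thesis by (rule iffD2[OF P_def])
  qed
  define q where "q n = p (diagseq n)" for n
  have q: "filterlim (\<lambda>n. dist x0 (q n)) at_top sequentially"
    unfolding q_def by (rule filterlim_compose[OF assms filterlim_subseq[OF subseq_diagseq]])
  have "convergent (\<lambda>n. geo x0 (q n) t)" if t: "t \<ge> 0" for t
  proof -
    obtain k :: nat where k: "t \<le> real k" using real_arch_simple by blast
    have "Cauchy (\<lambda>n. geo x0 (q n) (real k))"
      using iffD1[OF P_def P[of k]] unfolding q_def by (rule convergent_Cauchy)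
    have "Cauchy (\<lambda>n. geo x0 (q n) t)"
    proof (rule metric_CauchyI)
      fix e :: real assume "e > 0"
      then obtain M where M: "\<And>m n. m \<ge> M \<Longrightarrow> n \<ge> M \<Longrightarrow> dist (geo x0 (q m) (real k)) (geo x0 (q n) (real k)) < e"
        using \<open>Cauchy (\<lambda>n. geo x0 (q n) (real k))\<close> metric_CauchyD by blast
      obtain N where N: "\<And>n. n \<ge> N \<Longrightarrow> real k \<le> dist x0 (q n)"
        using q unfolding filterlim_at_top eventually_sequentially by blast
      have "dist (geo x0 (q m) t) (geo x0 (q n) t) < e" if "m \<ge> max M N" "n \<ge> max M N" for m n
        using geo_mono[OF t k N N, of m n] M[of m n] that by fastforce
      then show "\<exists>M. \<forall>m\<ge>M. \<forall>n\<ge>M. dist (geo x0 (q m) t) (geo x0 (q n) t) < e" by blast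
    qed
    then show ?thesis by (rule Cauchy_convergent)
  qed
  then have "approaches x0 q (asymptotic_rel `` {\<lambda>t. lim (\<lambda>n. geo x0 (q n) t)})"
    by (intro approachesI q) (auto simp: convergent_LIMSEQ_iff)
  then show ?thesis using subseq_diagseq unfolding q_def by (intro exI conjI)
qed

end

section \<open>The cone topology through approaching sequences\<close>

context conical_basepoint
begin

lemma Inl_in_cone_nbhd:
  assumes "0 \<le> r"
  shows "Inl y \<in> cone_nbhd x0 c r e \<longleftrightarrow> r < dist x0 y \<and> dist (geo x0 y r) (c r) < e"
proof -
  have "(\<exists>\<gamma>. geodesic_path \<gamma> x0 y \<and> dist (\<gamma> r) (c r) < e) \<longleftrightarrow> dist (geo x0 y r) (c r) < e" if "r < dist x0 y"
  proof
    assume "\<exists>\<gamma>. geodesic_path \<gamma> x0 y \<and> dist (\<gamma> r) (c r) < e"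
    then obtain \<gamma> where "geodesic_path \<gamma> x0 y" "dist (\<gamma> r) (c r) < e" by blast
    then show "dist (geo x0 y r) (c r) < e"
      using geodesic_path_eq_geo[of \<gamma> y r] assms that by simp
  next
    assume "dist (geo x0 y r) (c r) < e"
    then show "\<exists>\<gamma>. geodesic_path \<gamma> x0 y \<and> dist (\<gamma> r) (c r) < e"
      by (intro exI[of _ "geo x0 y"]) (simp add: geodesic_path_geo)
  qed
  then show ?thesis by (auto simp: cone_nbhd_def)
qed

lemma Inr_in_cone_nbhd:
  assumes "\<xi> \<in> visual_boundary" "d \<in> \<xi>" "d 0 = x0" "0 \<le> r"
  shows "Inr \<xi> \<in> cone_nbhd x0 c r e \<longleftrightarrow> dist (d r) (c r) < e"
proof -
  have "(\<exists>\<gamma>\<in>\<xi>. \<gamma> 0 = x0 \<and> dist (\<gamma> r) (c r) < e) \<longleftrightarrow> dist (d r) (c r) < e"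
    using ray_unique[OF assms(1,2) _ assms(3) _ assms(4)] assms(2,3) by metis
  then show ?thesis using assms(1) by (auto simp: cone_nbhd_def)
qed

lemma openin_cone_nbhd:
  "geodesic_ray c \<Longrightarrow> c 0 = x0 \<Longrightarrow> 0 < r \<Longrightarrow> 0 < e \<Longrightarrow> openin (cone_topology x0) (cone_nbhd x0 c r e)"
  unfolding cone_topology_def by (rule topology_generated_by_Basis) blast

lemma Inr_in_topspace:
  assumes "\<xi> \<in> visual_boundary"
  shows "Inr \<xi> \<in> topspace (cone_topology x0) \<longleftrightarrow> (\<exists>c\<in>\<xi>. c 0 = x0)"
proof
  assume "Inr \<xi> \<in> topspace (cone_topology x0)"
  then show "\<exists>c\<in>\<xi>. c 0 = x0"
    by (auto simp: cone_topology_def cone_nbhd_def)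
next
  assume "\<exists>c\<in>\<xi>. c 0 = x0"
  then obtain c where c: "c \<in> \<xi>" "c 0 = x0" by blast
  then have "Inr \<xi> \<in> cone_nbhd x0 c 1 1" using assms by (simp add: Inr_in_cone_nbhd)
  moreover have "openin (cone_topology x0) (cone_nbhd x0 c 1 1)"
    using c assms by (intro openin_cone_nbhd ray_of_boundary) auto
  ultimately show "Inr \<xi> \<in> topspace (cone_topology x0)" using openin_subset by blast
qed

text \<open>Closeness to \<open>c\<close> at a late time \<open>s\<close> is inherited at the earlier time \<open>r\<close>, because distances along
  geodesics from \<open>x0\<close> grow. Using \<open>1 / s\<close> as the tolerance at time \<open>s\<close> leaves one parameter to
  control both the time and the tolerance.\<close>

lemma cone_nbhd_shrink:
  assumes c: "geodesic_ray c" "c 0 = x0" and r: "0 \<le> r" "r \<le> s" and s: "dist (c r) (d r) + 1 / s \<le> e"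
  shows "cone_nbhd x0 c s (1 / s) \<subseteq> cone_nbhd x0 d r e"
proof -
  have tri: "dist p (d r) < e" if "dist p (c r) \<le> a" "a < 1 / s" for p a
    using that s dist_triangle[of p "d r" "c r"] by linarith
  have 1: "dist (geo x0 y r) (d r) < e" if "s < dist x0 y" "dist (geo x0 y s) (c s) < 1 / s" for y
    by (rule tri[OF geo_ray_mono[OF c r]]) (use that in auto)
  have 2: "dist (\<gamma> r) (d r) < e" if "geodesic_ray \<gamma>" "\<gamma> 0 = x0" "dist (\<gamma> s) (c s) < 1 / s" for \<gamma>
    by (rule tri[OF ray_ray_mono[OF that(1,2) c r] that(3)])
  show ?thesis
  proof
    fix z assume z: "z \<in> cone_nbhd x0 c s (1 / s)"
    show "z \<in> cone_nbhd x0 d r e"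
    proof (cases z)
      case (Inl y)
      then show ?thesis using z 1[of y] r by (auto simp: Inl_in_cone_nbhd)
    next
      case (Inr \<zeta>)
      then obtain \<gamma> where "\<zeta> \<in> visual_boundary" "\<gamma> \<in> \<zeta>" "\<gamma> 0 = x0" "dist (\<gamma> s) (c s) < 1 / s"
        using z by (auto simp: cone_nbhd_def)
      then show ?thesis using 2[of \<gamma>] ray_of_boundary[of \<zeta> \<gamma>] r Inr by (simp add: Inr_in_cone_nbhd)
    qed
  qed
qed

text \<open>The cone topology is given by a subbase. Cone neighbourhoods of the ray of \<open>\<xi>\<close> itself form a
  neighbourhood base at \<open>\<xi>\<close>: each subbasic neighbourhood, possibly centred at another ray, contains
  one, and any two contain a third.\<close>

lemma open_contains_cone_nbhd:
  assumes "openin (cone_topology x0) U" "Inr \<xi> \<in> U" and \<xi>: "\<xi> \<in> visual_boundary" "c \<in> \<xi>" "c 0 = x0"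
  shows "\<exists>s>0. cone_nbhd x0 c s (1 / s) \<subseteq> U"
proof -
  have ray: "geodesic_ray c" using \<xi> ray_of_boundary by blast
  have "generate_topology_on ({Inl ` U |U. open U} \<union>
      {cone_nbhd x0 c r e |c r e. geodesic_ray c \<and> c 0 = x0 \<and> 0 < r \<and> 0 < e}) U"
    using assms(1) unfolding cone_topology_def openin_topology_generated_by_iff .
  then show ?thesis using assms(2)
  proof (induction rule: generate_topology_on.induct)
    case (Int A B)
    then obtain s t where st: "s > 0" "cone_nbhd x0 c s (1 / s) \<subseteq> A" "t > 0" "cone_nbhd x0 c t (1 / t) \<subseteq> B"
      by blast
    have "cone_nbhd x0 c (max s t) (1 / max s t) \<subseteq> cone_nbhd x0 c s (1 / s)"
      "cone_nbhd x0 c (max s t) (1 / max s t) \<subseteq> cone_nbhd x0 c t (1 / t)"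
      using st by (intro cone_nbhd_shrink[OF ray \<xi>(3)]; simp add: frac_le)+
    with st show ?case by (intro exI[of _ "max s t"]) auto
  next
    case (UN K)
    then obtain k where "k \<in> K" "Inr \<xi> \<in> k" by blast
    with UN.IH show ?case by (meson Union_upper order_trans)
  next
    case (Basis V)
    then obtain d r e where V: "V = cone_nbhd x0 d r e" "0 < r" "0 < e" by auto
    with Basis have "dist (c r) (d r) < e" using \<xi> by (simp add: Inr_in_cone_nbhd)
    then have "0 < e - dist (c r) (d r)" by simp
    define s where "s = max r (1 / (e - dist (c r) (d r)))"
    have "1 / s \<le> e - dist (c r) (d r)" "r \<le> s" "0 < s"
      using \<open>0 < e - dist (c r) (d r)\<close> V(2) by (auto simp: s_def field_simps max_def)
    then show ?case
      using V cone_nbhd_shrink[OF ray \<xi>(3), of r s d e] by (intro exI[of _ s]) auto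
  qed auto
qed

lemma approaches_eventually_in_open:
  assumes "approaches x0 p \<xi>" "openin (cone_topology x0) U" "Inr \<xi> \<in> U"
  shows "eventually (\<lambda>n. Inl (p n) \<in> U) sequentially"
proof -
  obtain c where c: "\<xi> \<in> visual_boundary" "c \<in> \<xi>" "c 0 = x0" and
    p: "filterlim (\<lambda>n. dist x0 (p n)) at_top sequentially" "\<And>t. t \<ge> 0 \<Longrightarrow> (\<lambda>n. geo x0 (p n) t) \<longlonglongrightarrow> c t"
    using assms(1) unfolding approaches_def by blast
  obtain s where s: "s > 0" "cone_nbhd x0 c s (1 / s) \<subseteq> U"
    using open_contains_cone_nbhd[OF assms(2,3) c] by blast
  have "eventually (\<lambda>n. dist (geo x0 (p n) s) (c s) < 1 / s) sequentially"
    using p(2)[of s] s(1) by (intro tendstoD) auto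
  moreover have "eventually (\<lambda>n. s < dist x0 (p n)) sequentially"
    using p(1) by (simp add: filterlim_at_top_dense)
  ultimately show ?thesis
    by eventually_elim (use s in \<open>auto simp: Inl_in_cone_nbhd\<close>)
qed

text \<open>Countably many cone neighbourhoods form a base at a boundary point, so limit points of a set are
  limits of sequences in it.\<close>

lemma boundary_limit_points_iff:
  "\<xi> \<in> boundary_limit_points x0 A \<longleftrightarrow> (\<exists>p. (\<forall>n. p n \<in> A) \<and> approaches x0 p \<xi>)"
proof
  assume "\<xi> \<in> boundary_limit_points x0 A"
  then have \<xi>: "\<xi> \<in> visual_boundary" and lim: "Inr \<xi> \<in> cone_topology x0 derived_set_of (Inl ` A)"
    by (auto simp: boundary_limit_points_def)
  then obtain c where c: "c \<in> \<xi>" "c 0 = x0"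
    using Inr_in_topspace[OF \<xi>] by (auto simp: in_derived_set_of)
  have "\<exists>y\<in>A. real (Suc n) < dist x0 y \<and> dist (geo x0 y (Suc n)) (c (Suc n)) < 1" for n
  proof -
    have "Inr \<xi> \<in> cone_nbhd x0 c (Suc n) 1" using \<xi> c by (simp add: Inr_in_cone_nbhd)
    moreover have "openin (cone_topology x0) (cone_nbhd x0 c (Suc n) 1)"
      using c \<xi> ray_of_boundary by (intro openin_cone_nbhd) auto
    ultimately obtain z where "z \<in> Inl ` A" "z \<in> cone_nbhd x0 c (Suc n) 1"
      using lim unfolding in_derived_set_of by blast
    then show ?thesis by (auto simp: Inl_in_cone_nbhd)
  qed
  then obtain p where p: "\<And>n. p n \<in> A" "\<And>n. real (Suc n) < dist x0 (p n)"
    "\<And>n. dist (geo x0 (p n) (Suc n)) (c (Suc n)) < 1" by metis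
  have "approaches x0 p \<xi>"
  proof (rule approaches_criterion[OF \<xi> c])
    show "filterlim (\<lambda>n. real (Suc n)) at_top sequentially"
      by (rule filterlim_compose[OF filterlim_real_sequentially filterlim_Suc])
    show "real (Suc n) \<le> dist x0 (p n)" for n using p(2)[of n] by simp
    show "dist (geo x0 (p n) (real (Suc n))) (c (real (Suc n))) \<le> 1" for n using p(3)[of n] by simp
  qed
  with p show "\<exists>p. (\<forall>n. p n \<in> A) \<and> approaches x0 p \<xi>" by blast
next
  assume "\<exists>p. (\<forall>n. p n \<in> A) \<and> approaches x0 p \<xi>"
  then obtain p where p: "\<And>n. p n \<in> A" "approaches x0 p \<xi>" by blast
  then have \<xi>: "\<xi> \<in> visual_boundary" "\<exists>c\<in>\<xi>. c 0 = x0" by (auto simp: approaches_def)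
  have "\<exists>y. y \<noteq> Inr \<xi> \<and> y \<in> Inl ` A \<and> y \<in> U" if "openin (cone_topology x0) U" "Inr \<xi> \<in> U" for U
    using eventually_happens[OF approaches_eventually_in_open[OF p(2) that]] p(1) by auto
  then have "Inr \<xi> \<in> cone_topology x0 derived_set_of (Inl ` A)"
    using \<xi> by (auto simp: in_derived_set_of Inr_in_topspace)
  then show "\<xi> \<in> boundary_limit_points x0 A" using \<xi> by (simp add: boundary_limit_points_def)
qed

text \<open>The factor \<open>2\<close> leaves room for two collars, defined below, to be disjoint. It is gained by
  doubling the time of a cone neighbourhood inside \<open>E\<close>.\<close>

lemma openin_boundaryD:
  assumes "openin (boundary_topology x0) E" "\<xi> \<in> E"
  shows "\<exists>c\<in>\<xi>. \<exists>s>0. c 0 = x0 \<and> (\<forall>\<zeta>\<in>visual_boundary. \<forall>d\<in>\<zeta>. d 0 = x0 \<and> dist (d s) (c s) < 2 / s \<longrightarrow> \<zeta> \<in> E)"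
proof -
  obtain U where U: "openin (cone_topology x0) U" "E = Inr -` U \<inter> visual_boundary"
    using assms(1) by (auto simp: boundary_topology_def openin_pullback_topology)
  with assms have \<xi>: "\<xi> \<in> visual_boundary" "Inr \<xi> \<in> U" by auto
  then have "Inr \<xi> \<in> topspace (cone_topology x0)" using U(1) openin_subset by blast
  then obtain c where c: "c \<in> \<xi>" "c 0 = x0" using Inr_in_topspace \<xi> by blast
  then obtain s where s: "s > 0" "cone_nbhd x0 c s (1 / s) \<subseteq> U"
    using open_contains_cone_nbhd[OF U(1) \<xi>(2,1)] by blast
  have "\<zeta> \<in> E" if \<zeta>: "\<zeta> \<in> visual_boundary" "d \<in> \<zeta>" "d 0 = x0" "dist (d (2 * s)) (c (2 * s)) < 2 / (2 * s)" for \<zeta> d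
  proof -
    have "dist (d s) (c s) \<le> dist (d (2 * s)) (c (2 * s))"
      using \<zeta> c s \<xi> ray_of_boundary by (intro ray_ray_mono) auto
    also have "\<dots> < 1 / s" using \<zeta>(4) by simp
    finally have "Inr \<zeta> \<in> cone_nbhd x0 c s (1 / s)" using \<zeta> s(1) by (simp add: Inr_in_cone_nbhd)
    then show ?thesis using s U \<zeta> by auto
  qed
  then show ?thesis using c s(1) by (intro bexI[of _ c] exI[of _ "2 * s"]) auto
qed

end

section \<open>Connectedness from coarse chains\<close>

text \<open>A neighbourhood in the space of the boundary points in \<open>E \<inter> S\<close>: around each of them a cone
  neighbourhood is taken with half the tolerance that would keep its boundary points inside \<open>E\<close>.
  As in a metric space, halving makes the neighbourhoods of separated sets disjoint, whereas
  arbitrary open sets of the cone topology that separate \<open>S\<close> may meet inside the space.\<close>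

definition collar :: "'a::metric_space \<Rightarrow> (real \<Rightarrow> 'a) set set \<Rightarrow> (real \<Rightarrow> 'a) set set \<Rightarrow> 'a set" where
  "collar x E S = {p. \<exists>\<xi>\<in>E \<inter> S. \<exists>c\<in>\<xi>. \<exists>s>0. c 0 = x \<and>
     (\<forall>\<zeta>\<in>visual_boundary. \<forall>d\<in>\<zeta>. d 0 = x \<and> dist (d s) (c s) < 2 / s \<longrightarrow> \<zeta> \<in> E) \<and>
     s < dist x p \<and> dist (geo x p s) (c s) < 1 / s}"

context conical_basepoint
begin

lemma approaches_eventually_in_collar:
  assumes "openin (boundary_topology x0) E" "\<xi> \<in> E \<inter> S" "approaches x0 p \<xi>"
  shows "eventually (\<lambda>n. p n \<in> collar x0 E S) sequentially"
proof -
  obtain c s where c: "c \<in> \<xi>" "s > 0" "c 0 = x0" and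
    cs: "\<forall>\<zeta>\<in>visual_boundary. \<forall>d\<in>\<zeta>. d 0 = x0 \<and> dist (d s) (c s) < 2 / s \<longrightarrow> \<zeta> \<in> E"
    using openin_boundaryD[OF assms(1)] assms(2) by blast
  have \<xi>: "\<xi> \<in> visual_boundary" using assms(3) by (simp add: approaches_def)
  have "eventually (\<lambda>n. Inl (p n) \<in> cone_nbhd x0 c s (1 / s)) sequentially"
    using c \<xi> ray_of_boundary
    by (intro approaches_eventually_in_open[OF assms(3)] openin_cone_nbhd) (auto simp: Inr_in_cone_nbhd)
  then show ?thesis
  proof eventually_elim
    case (elim n)
    then show ?case using assms(2) c cs unfolding collar_def by (auto simp: Inl_in_cone_nbhd)
  qed
qed

lemma rays_close_if_sharing_point:
  assumes "\<xi> \<in> visual_boundary" "\<zeta> \<in> visual_boundary" "c \<in> \<xi>" "d \<in> \<zeta>" "c 0 = x0" "d 0 = x0"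
    and "0 < s" "s \<le> t" "t < dist x0 p"
    and "dist (geo x0 p s) (c s) < 1 / s" "dist (geo x0 p t) (d t) < 1 / t"
  shows "dist (d s) (c s) < 2 / s"
proof -
  have "dist (geo x0 p s) (d s) \<le> dist (geo x0 p t) (d t)"
    using assms ray_of_boundary by (intro geo_ray_mono) auto
  also have "\<dots> < 1 / t" by fact
  also have "\<dots> \<le> 1 / s" using assms by (simp add: frac_le)
  finally have "dist (d s) (c s) < 1 / s + 1 / s"
    using assms(10) dist_triangle3[of "d s" "c s" "geo x0 p s"] by linarith
  then show ?thesis by simp
qed

lemma collars_disjoint:
  assumes "S \<subseteq> visual_boundary" "E \<inter> F \<inter> S = {}"
  shows "collar x0 E S \<inter> collar x0 F S = {}"
proof (rule ccontr)
  assume "collar x0 E S \<inter> collar x0 F S \<noteq> {}"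
  then obtain p where p: "p \<in> collar x0 E S" "p \<in> collar x0 F S" by blast
  from p(1) obtain \<xi> c s where
    \<xi>: "\<xi> \<in> E \<inter> S" "c \<in> \<xi>" "s > 0" "c 0 = x0" "s < dist x0 p" "dist (geo x0 p s) (c s) < 1 / s"
    "\<forall>\<zeta>\<in>visual_boundary. \<forall>d\<in>\<zeta>. d 0 = x0 \<and> dist (d s) (c s) < 2 / s \<longrightarrow> \<zeta> \<in> E"
    unfolding collar_def by blast
  from p(2) obtain \<zeta> d t where
    \<zeta>: "\<zeta> \<in> F \<inter> S" "d \<in> \<zeta>" "t > 0" "d 0 = x0" "t < dist x0 p" "dist (geo x0 p t) (d t) < 1 / t"
    "\<forall>\<zeta>\<in>visual_boundary. \<forall>e\<in>\<zeta>. e 0 = x0 \<and> dist (e t) (d t) < 2 / t \<longrightarrow> \<zeta> \<in> F"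
    unfolding collar_def by blast
  have vb: "\<xi> \<in> visual_boundary" "\<zeta> \<in> visual_boundary" using \<xi> \<zeta> assms by auto
  show False
  proof (cases "s \<le> t")
    case True
    then have "\<zeta> \<in> E" using \<xi> \<zeta> vb rays_close_if_sharing_point[of \<xi> \<zeta> c d s t p] by blast
    then show False using \<zeta>(1) assms(2) by blast
  next
    case False
    then have "\<xi> \<in> F" using \<xi> \<zeta> vb rays_close_if_sharing_point[of \<zeta> \<xi> d c t s p] by force
    then show False using \<xi>(1) assms(2) by blast
  qed
qed

text \<open>Suppose \<open>S\<close> is covered by two open sets that are disjoint on \<open>S\<close>. Each chain from near a point
  of the first to near a point of the second has a step that leaves the collar of the first. The
  points before and after these steps have a common subsequential limit in \<open>S\<close>, as the steps are
  bounded. If it lies in the first set, the later points are eventually in the first collar; if it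
  lies in the second, the earlier points are eventually in the second collar. Both are impossible.\<close>

lemma connectedin_if_chains:
  assumes S: "\<And>\<xi>. \<xi> \<in> S \<Longrightarrow> \<xi> \<in> visual_boundary \<and> (\<exists>c\<in>\<xi>. c 0 = x0)"
    and chains: "\<And>\<xi> \<zeta>. \<xi> \<in> S \<Longrightarrow> \<zeta> \<in> S \<Longrightarrow> \<exists>D (k :: nat \<Rightarrow> nat \<Rightarrow> 'a) m.
      approaches x0 (\<lambda>n. k n 0) \<xi> \<and> approaches x0 (\<lambda>n. k n (m n)) \<zeta> \<and>
      (\<forall>n. \<forall>i<m n. dist (k n i) (k n (Suc i)) \<le> D) \<and>
      (\<forall>i. (\<forall>n. i n \<le> m n) \<longrightarrow> (\<exists>r. \<exists>\<omega>\<in>S. strict_mono r \<and> approaches x0 (\<lambda>n. k (r n) (i (r n))) \<omega>))"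
  shows "connectedin (boundary_topology x0) S"
  unfolding connectedin
proof (intro conjI notI)
  show "S \<subseteq> topspace (boundary_topology x0)"
    using S Inr_in_topspace by (auto simp: boundary_topology_def topspace_pullback_topology)
  have vb: "S \<subseteq> visual_boundary" using S by blast
  assume "\<exists>E1 E2. openin (boundary_topology x0) E1 \<and> openin (boundary_topology x0) E2 \<and>
    S \<subseteq> E1 \<union> E2 \<and> E1 \<inter> E2 \<inter> S = {} \<and> E1 \<inter> S \<noteq> {} \<and> E2 \<inter> S \<noteq> {}"
  then obtain E F \<xi> \<zeta> where op: "openin (boundary_topology x0) E" "openin (boundary_topology x0) F"
    and cover: "S \<subseteq> E \<union> F" "E \<inter> F \<inter> S = {}" and pts: "\<xi> \<in> E \<inter> S" "\<zeta> \<in> F \<inter> S" by blast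
  let ?V = "collar x0 E S" and ?W = "collar x0 F S"
  have disj: "?V \<inter> ?W = {}" by (rule collars_disjoint[OF vb cover(2)])
  from chains[OF IntD2[OF pts(1)] IntD2[OF pts(2)]] obtain D and k :: "nat \<Rightarrow> nat \<Rightarrow> 'a" and m where
    chain: "approaches x0 (\<lambda>n. k n 0) \<xi> \<and> approaches x0 (\<lambda>n. k n (m n)) \<zeta> \<and>
      (\<forall>n. \<forall>i<m n. dist (k n i) (k n (Suc i)) \<le> D) \<and>
      (\<forall>i. (\<forall>n. i n \<le> m n) \<longrightarrow> (\<exists>r. \<exists>\<omega>\<in>S. strict_mono r \<and> approaches x0 (\<lambda>n. k (r n) (i (r n))) \<omega>))"
    by blast
  then have ends: "approaches x0 (\<lambda>n. k n 0) \<xi>" "approaches x0 (\<lambda>n. k n (m n)) \<zeta>"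
    and step: "\<And>n i. i < m n \<Longrightarrow> dist (k n i) (k n (Suc i)) \<le> D" by auto
  have "eventually (\<lambda>n. k n 0 \<in> ?V \<and> k n (m n) \<in> ?W) sequentially"
    using approaches_eventually_in_collar[OF op(1) pts(1) ends(1)]
      approaches_eventually_in_collar[OF op(2) pts(2) ends(2)] by eventually_elim blast
  then obtain N where N: "\<And>n. n \<ge> N \<Longrightarrow> k n 0 \<in> ?V \<and> k n (m n) \<in> ?W"
    unfolding eventually_sequentially by blast
  have "\<exists>i<m n. k n i \<in> ?V \<and> k n (Suc i) \<notin> ?V" if "n \<ge> N" for n
  proof (rule ccontr)
    assume "\<not> ?thesis"
    then have "k n i \<in> ?V" if "i \<le> m n" for i
      using that by (induction i) (use N[OF \<open>n \<ge> N\<close>] in auto)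
    then show False using N[OF that] disj by blast
  qed
  then have "\<exists>i\<le>m n. n \<ge> N \<longrightarrow> i < m n \<and> k n i \<in> ?V \<and> k n (Suc i) \<notin> ?V" for n
    by (cases "n \<ge> N") (auto intro: less_imp_le)
  then obtain i where i: "\<And>n. i n \<le> m n"
    "\<And>n. n \<ge> N \<Longrightarrow> i n < m n \<and> k n (i n) \<in> ?V \<and> k n (Suc (i n)) \<notin> ?V" by metis
  obtain r \<omega> where r: "\<omega> \<in> S" "strict_mono r" "approaches x0 (\<lambda>n. k (r n) (i (r n))) \<omega>"
    using chain i(1) by blast
  have big: "eventually (\<lambda>n. r n \<ge> N) sequentially"
    using filterlim_subseq[OF r(2)] by (simp add: filterlim_at_top)
  have r': "approaches x0 (\<lambda>n. k (r n) (Suc (i (r n)))) \<omega>"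
    by (rule approaches_bounded_perturbation[OF r(3), of _ D])
      (use big in \<open>eventually_elim; use i step in blast\<close>)
  consider "\<omega> \<in> E \<inter> S" | "\<omega> \<in> F \<inter> S" using r(1) cover by blast
  then show False
  proof cases
    case 1
    have "eventually (\<lambda>n. False) sequentially"
      using approaches_eventually_in_collar[OF op(1) 1 r'] big by eventually_elim (use i in blast)
    then show False by simp
  next
    case 2
    have "eventually (\<lambda>n. False) sequentially"
      using approaches_eventually_in_collar[OF op(2) 2 r(3)] big by eventually_elim (use i disj in blast)
    then show False by simp
  qed
qed

end

section \<open>Orbits of geometric actions\<close>

lemma geometric_actionD:
  assumes "geometric_action G \<alpha>"
  shows "group G"
    and "g \<in> carrier G \<Longrightarrow> h \<in> carrier G \<Longrightarrow> \<alpha> (g \<otimes>\<^bsub>G\<^esub> h) x = \<alpha> g (\<alpha> h x)"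
    and "\<alpha> \<one>\<^bsub>G\<^esub> x = x"
    and "g \<in> carrier G \<Longrightarrow> dist (\<alpha> g x) (\<alpha> g y) = dist x y"
proof -
  interpret group_action G UNIV \<alpha> using assms by (simp add: geometric_action_def)
  show "group G" using group_hom by (simp add: group_hom_def)
  show "g \<in> carrier G \<Longrightarrow> h \<in> carrier G \<Longrightarrow> \<alpha> (g \<otimes>\<^bsub>G\<^esub> h) x = \<alpha> g (\<alpha> h x)"
    by (rule composition_rule) auto
  have "\<alpha> \<one>\<^bsub>G\<^esub> = (\<lambda>x\<in>UNIV. x)" by (rule id_eq_one[symmetric])
  then show "\<alpha> \<one>\<^bsub>G\<^esub> x = x" by simp
  show "g \<in> carrier G \<Longrightarrow> dist (\<alpha> g x) (\<alpha> g y) = dist x y"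
    using assms by (simp add: geometric_action_def)
qed

lemma dist_orbit_points:
  assumes "geometric_action G \<alpha>" "g \<in> carrier G" "h \<in> carrier G"
  shows "dist x (\<alpha> (inv\<^bsub>G\<^esub> g \<otimes>\<^bsub>G\<^esub> h) x) = dist (\<alpha> g x) (\<alpha> h x)"
proof -
  interpret group G by (rule geometric_actionD[OF assms(1)])
  have "dist x (\<alpha> (inv\<^bsub>G\<^esub> g \<otimes>\<^bsub>G\<^esub> h) x) = dist (\<alpha> g x) (\<alpha> g (\<alpha> (inv\<^bsub>G\<^esub> g \<otimes>\<^bsub>G\<^esub> h) x))"
    using geometric_actionD(4)[OF assms(1,2)] by simp
  also have "\<alpha> g (\<alpha> (inv\<^bsub>G\<^esub> g \<otimes>\<^bsub>G\<^esub> h) x) = \<alpha> (g \<otimes>\<^bsub>G\<^esub> (inv\<^bsub>G\<^esub> g \<otimes>\<^bsub>G\<^esub> h)) x"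
    using assms by (intro geometric_actionD(2)[symmetric]) auto
  also have "g \<otimes>\<^bsub>G\<^esub> (inv\<^bsub>G\<^esub> g \<otimes>\<^bsub>G\<^esub> h) = h"
    using assms by (simp add: m_assoc[symmetric])
  finally show ?thesis .
qed

text \<open>The properness hypothesis is local. If infinitely many group elements moved \<open>x\<close> by a bounded
  amount, their orbit points would accumulate at some \<open>l\<close>, and infinitely many quotients of these
  elements would move a point of a small ball about \<open>l\<close> into that ball.\<close>

lemma finite_small_displacement:
  fixes x :: "'a::heine_borel"
  assumes "geometric_action G \<alpha>"
  shows "finite {g \<in> carrier G. dist x (\<alpha> g x) \<le> R}"
proof (rule ccontr)
  interpret group G by (rule geometric_actionD[OF assms])
  assume "\<not> ?thesis"
  then obtain f :: "nat \<Rightarrow> 'b" where f: "inj f" "range f \<subseteq> {g \<in> carrier G. dist x (\<alpha> g x) \<le> R}"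
    using infinite_countable_subset by blast
  then have fG: "f n \<in> carrier G" for n by auto
  have "bounded (range (\<lambda>n. \<alpha> (f n) x))"
    unfolding bounded_def using f(2) by (intro exI[of _ x] exI[of _ R]) auto
  then obtain l r where r: "strict_mono (r :: nat \<Rightarrow> nat)" "(\<lambda>n. \<alpha> (f (r n)) x) \<longlonglongrightarrow> l"
    using bounded_imp_convergent_subsequence by (fastforce simp: o_def)
  obtain e where e: "e > 0" "finite {g \<in> carrier G. \<alpha> g ` ball l e \<inter> ball l e \<noteq> {}}" (is "finite ?F")
    using assms unfolding geometric_action_def by blast
  obtain N where N: "\<And>n. n \<ge> N \<Longrightarrow> \<alpha> (f (r n)) x \<in> ball l e"
    using tendstoD[OF r(2) e(1)] by (auto simp: eventually_sequentially dist_commute)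
  define k where "k n = f (r n) \<otimes>\<^bsub>G\<^esub> inv\<^bsub>G\<^esub> (f (r N))" for n
  have "k n \<in> ?F" if "n \<ge> N" for n
  proof -
    have "k n \<in> carrier G" using fG by (simp add: k_def)
    moreover have "\<alpha> (k n) (\<alpha> (f (r N)) x) = \<alpha> (k n \<otimes>\<^bsub>G\<^esub> f (r N)) x"
      using fG \<open>k n \<in> carrier G\<close> by (intro geometric_actionD(2)[OF assms, symmetric])
    moreover have "k n \<otimes>\<^bsub>G\<^esub> f (r N) = f (r n)"
      using fG by (simp add: k_def m_assoc)
    ultimately show ?thesis using N[OF that] N[of N] by (auto intro!: image_eqI exI[of _ "\<alpha> (f (r n)) x"])
  qed
  then have "finite (k ` {N..})" by (intro finite_subset[OF _ e(2)]) auto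
  moreover have "inj_on k {N..}"
    using fG inj_eq[OF f(1)] strict_mono_eq[OF r(1)] by (auto simp: inj_on_def k_def)
  ultimately show False using finite_imageD infinite_Ici by blast
qed

lemma cobounded_orbit:
  fixes x :: "'a::heine_borel"
  assumes "geometric_action G \<alpha>"
  shows "\<exists>R\<ge>0. \<forall>y. \<exists>g\<in>carrier G. dist (\<alpha> g x) y \<le> R"
proof -
  obtain K where K: "compact K" "(\<Union>g\<in>carrier G. \<alpha> g ` K) = UNIV"
    using assms by (auto simp: geometric_action_def)
  obtain R where R: "\<And>y. y \<in> K \<Longrightarrow> dist x y \<le> R"
    using compact_imp_bounded[OF K(1)] bounded_any_center[of K x] by blast
  have "\<exists>g\<in>carrier G. dist (\<alpha> g x) y \<le> max R 0" for y
  proof -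
    obtain g u where "g \<in> carrier G" "u \<in> K" "y = \<alpha> g u" using K(2) by blast
    then show ?thesis using R[of u] geometric_actionD(4)[OF assms, of g x u] by (intro bexI[of _ g]) auto
  qed
  then show ?thesis by (intro exI[of _ "max R 0"]) auto
qed

text \<open>Up to left translation there are finitely many pairs of group elements whose orbit points in the
  first space are within \<open>R\<close>.\<close>

lemma orbit_map_coarse:
  fixes x :: "'a::heine_borel" and z :: "'b::metric_space"
  assumes \<alpha>: "geometric_action G \<alpha>" and \<beta>: "geometric_action G \<beta>"
  shows "\<exists>M\<ge>0. \<forall>g\<in>carrier G. \<forall>h\<in>carrier G. dist (\<alpha> g x) (\<alpha> h x) \<le> R \<longrightarrow> dist (\<beta> g z) (\<beta> h z) \<le> M"
proof -
  interpret group G by (rule geometric_actionD[OF \<alpha>])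
  let ?F = "{g \<in> carrier G. dist x (\<alpha> g x) \<le> R}"
  define M where "M = Max (insert 0 ((\<lambda>g. dist z (\<beta> g z)) ` ?F))"
  have fin: "finite (insert 0 ((\<lambda>g. dist z (\<beta> g z)) ` ?F))"
    using finite_small_displacement[OF \<alpha>, of x R] by simp
  have "dist (\<beta> g z) (\<beta> h z) \<le> M"
    if "g \<in> carrier G" "h \<in> carrier G" "dist (\<alpha> g x) (\<alpha> h x) \<le> R" for g h
  proof -
    have "inv\<^bsub>G\<^esub> g \<otimes>\<^bsub>G\<^esub> h \<in> ?F" using that dist_orbit_points[OF \<alpha>, of g h x] by simp
    then have "dist z (\<beta> (inv\<^bsub>G\<^esub> g \<otimes>\<^bsub>G\<^esub> h) z) \<le> M"
      unfolding M_def by (intro Max_ge fin) auto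
    then show ?thesis using dist_orbit_points[OF \<beta>, of g h z] that by simp
  qed
  moreover have "0 \<le> M" unfolding M_def by (rule Max_ge[OF fin]) simp
  ultimately show ?thesis by blast
qed

context conical_basepoint
begin

text \<open>One half of the orbit map \<open>g x0 \<mapsto> g z\<close> being a quasi-isometry: the geodesic from \<open>x0\<close> to \<open>g x0\<close> is
  followed in unit steps by nearby orbit points, and each step has bounded effect on the orbit
  of \<open>z\<close>.\<close>

lemma orbit_map_linear_bound:
  fixes z :: "'b::metric_space"
  assumes \<alpha>: "geometric_action G \<alpha>" and \<beta>: "geometric_action G \<beta>"
  shows "\<exists>M\<ge>0. \<forall>g\<in>carrier G. dist z (\<beta> g z) \<le> M * (dist x0 (\<alpha> g x0) + 1)"
proof -
  interpret group G by (rule geometric_actionD[OF \<alpha>])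
  obtain R where R: "R \<ge> 0" "\<And>y. \<exists>g\<in>carrier G. dist (\<alpha> g x0) y \<le> R"
    using cobounded_orbit[OF \<alpha>] by blast
  obtain M where M: "M \<ge> 0" "\<And>g h. g \<in> carrier G \<Longrightarrow> h \<in> carrier G \<Longrightarrow>
      dist (\<alpha> g x0) (\<alpha> h x0) \<le> 2 * R + 1 \<Longrightarrow> dist (\<beta> g z) (\<beta> h z) \<le> M"
    using orbit_map_coarse[OF \<alpha> \<beta>, of x0 "2 * R + 1" z] by blast
  have "dist z (\<beta> g z) \<le> M * (dist x0 (\<alpha> g x0) + 1)" if g: "g \<in> carrier G" for g
  proof -
    let ?y = "\<alpha> g x0"
    \<comment> \<open>the successor keeps \<open>N\<close> positive, so that the walk can start at the identity and end at \<open>g\<close>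
       even if \<open>g\<close> fixes \<open>x0\<close>\<close>
    define N where "N = Suc (nat \<lfloor>dist x0 ?y\<rfloor>)"
    have N: "dist x0 ?y \<le> real N" "real N \<le> dist x0 ?y + 1" by (auto simp: N_def) linarith+
    have "\<exists>k\<in>carrier G. dist (\<alpha> k x0) (geo x0 ?y (real i)) \<le> R \<and> (i = 0 \<longrightarrow> k = \<one>\<^bsub>G\<^esub>) \<and> (i = N \<longrightarrow> k = g)" for i
    proof -
      consider "i = 0" | "i = N" "i \<noteq> 0" | "i \<noteq> 0" "i \<noteq> N" by blast
      then show ?thesis
      proof cases
        case 1
        then show ?thesis
          using R(1) geometric_actionD(3)[OF \<alpha>] by (intro bexI[of _ "\<one>\<^bsub>G\<^esub>"]) (auto simp: geo_0 N_def)
      next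
        case 2
        then show ?thesis using R(1) g N by (intro bexI[of _ g]) (auto simp: geo_beyond)
      next
        case 3
        then show ?thesis using R(2)[of "geo x0 ?y (real i)"] by blast
      qed
    qed
    then obtain k where k: "\<And>i. k i \<in> carrier G" "\<And>i. dist (\<alpha> (k i) x0) (geo x0 ?y (real i)) \<le> R"
      "k 0 = \<one>\<^bsub>G\<^esub>" "k N = g" by metis
    have step: "dist (\<beta> (k i) z) (\<beta> (k (Suc i)) z) \<le> M" for i
    proof -
      have "dist (geo x0 ?y (real i)) (geo x0 ?y (real (Suc i))) \<le> \<bar>real i - real (Suc i)\<bar>"
        by (rule dist_geo_geo_le) auto
      then have "dist (geo x0 ?y (real i)) (geo x0 ?y (real (Suc i))) \<le> 1" by simp
      then have "dist (\<alpha> (k i) x0) (\<alpha> (k (Suc i)) x0) \<le> 2 * R + 1"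
        using k(2)[of i] k(2)[of "Suc i"]
          dist_triangle[of "\<alpha> (k i) x0" "\<alpha> (k (Suc i)) x0" "geo x0 ?y (real i)"]
          dist_triangle2[of "geo x0 ?y (real i)" "\<alpha> (k (Suc i)) x0" "geo x0 ?y (real (Suc i))"] by linarith
      then show ?thesis by (rule M(2)[OF k(1) k(1)])
    qed
    have "dist z (\<beta> (k i) z) \<le> real i * M" for i
    proof (induction i)
      case 0
      then show ?case by (simp add: k(3) geometric_actionD(3)[OF \<beta>])
    next
      case (Suc i)
      then show ?case using step[of i] dist_triangle[of z "\<beta> (k (Suc i)) z" "\<beta> (k i) z"]
        by (simp add: algebra_simps)
    qed
    from this[of N] have "dist z (\<beta> g z) \<le> real N * M" by (simp add: k(4))
    also have "\<dots> \<le> (dist x0 ?y + 1) * M" using N M(1) by (intro mult_right_mono)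
    finally show ?thesis by (simp add: mult.commute)
  qed
  then show ?thesis using M(1) by blast
qed

text \<open>The chain runs from \<open>p\<close> back towards \<open>x0\<close> until time \<open>r\<close>, jumps to the geodesic of \<open>q\<close>, and follows
  it out to \<open>q\<close>. The geodesic to any point of the chain is an initial part of one of these two.\<close>

lemma ex_chain_outside_ball:
  assumes "0 \<le> r" "r \<le> dist x0 p" "r \<le> dist x0 q"
  shows "\<exists>u m. 0 < m \<and> u 0 = p \<and> u m = q \<and>
    (\<forall>i. dist (u i) (u (Suc i)) \<le> 1 + dist (geo x0 p r) (geo x0 q r)) \<and>
    (\<forall>i. r \<le> dist x0 (u i) \<and> (geo x0 (u i) r = geo x0 p r \<or> geo x0 (u i) r = geo x0 q r))"
proof -
  \<comment> \<open>\<open>s\<close> and \<open>t\<close> are the times of the inward and of the outward part of the chain; the jump takes place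
     between the indices \<open>A\<close> and \<open>A + 1\<close>\<close>
  define A B where "A = nat \<lceil>dist x0 p\<rceil>" and "B = nat \<lceil>dist x0 q\<rceil>"
  define s where "s i = max r (dist x0 p - real i)" for i
  define t where "t i = min (dist x0 q) (r + (real i - real A - 1))" for i
  define u where "u i = (if i \<le> A then geo x0 p (s i) else geo x0 q (t i))" for i
  have A: "dist x0 p \<le> real A" and B: "dist x0 q \<le> real B" by (auto simp: A_def B_def)
  have s: "r \<le> s i" "s i \<le> dist x0 p" for i using assms by (auto simp: s_def)
  have t: "r \<le> t i" "t i \<le> dist x0 q" if "\<not> i \<le> A" for i
    using assms that by (auto simp: t_def)
  have "u 0 = p" using assms(2) by (simp add: u_def s_def geo_beyond)
  moreover have "u (A + 1 + B) = q"
    using assms B by (simp add: u_def t_def geo_beyond)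
  moreover have "dist (u i) (u (Suc i)) \<le> 1 + dist (geo x0 p r) (geo x0 q r)" for i
  proof -
    consider "Suc i \<le> A" | "i = A" | "\<not> i \<le> A" by linarith
    then show ?thesis
    proof cases
      case 1
      have "dist (geo x0 p (s i)) (geo x0 p (s (Suc i))) \<le> \<bar>s i - s (Suc i)\<bar>"
        using s[of i] s[of "Suc i"] assms by (intro dist_geo_geo_le) auto
      also have "\<dots> \<le> 1" by (auto simp: s_def)
      finally show ?thesis using 1 zero_le_dist[of "geo x0 p r" "geo x0 q r"] by (simp add: u_def del: zero_le_dist)
    next
      case 2
      have "s A = r" "t (Suc A) = r" using assms A by (auto simp: s_def t_def)
      then show ?thesis using 2 by (simp add: u_def)
    next
      case 3
      have "dist (geo x0 q (t i)) (geo x0 q (t (Suc i))) \<le> \<bar>t i - t (Suc i)\<bar>"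
        using t[of i] t[of "Suc i"] 3 assms by (intro dist_geo_geo_le) auto
      also have "\<dots> \<le> 1" by (auto simp: t_def)
      finally show ?thesis using 3 zero_le_dist[of "geo x0 p r" "geo x0 q r"] by (simp add: u_def del: zero_le_dist)
    qed
  qed
  moreover have "r \<le> dist x0 (u i) \<and> (geo x0 (u i) r = geo x0 p r \<or> geo x0 (u i) r = geo x0 q r)" for i
  proof (cases "i \<le> A")
    case True
    then show ?thesis using s[of i] assms(1) by (simp add: u_def dist_geo geo_geo)
  next
    case False
    then show ?thesis using t[of i] assms(1) by (simp add: u_def dist_geo geo_geo)
  qed
  ultimately show ?thesis by (intro exI[of _ u] exI[of _ "A + 1 + B"]) auto
qed

text \<open>Neighbourhoods of a boundary point are coarsely connected. If the orbit points of \<open>g\<close> and \<open>h\<close> both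
  approach \<open>\<eta>\<close>, they are joined outside the ball of radius \<open>n\<close>, for large indices \<open>j n\<close> at which both
  geodesics are still close to the ray of \<open>\<eta>\<close> at time \<open>n\<close>; all points of the chain then inherit this
  closeness. Replacing them by orbit points costs a bounded displacement.\<close>

lemma ex_group_chains:
  assumes \<beta>: "geometric_action G \<beta>"
    and g: "\<And>n. g n \<in> carrier G" "approaches x0 (\<lambda>n. \<beta> (g n) x0) \<eta>"
    and h: "\<And>n. h n \<in> carrier G" "approaches x0 (\<lambda>n. \<beta> (h n) x0) \<eta>"
  shows "\<exists>R (j :: nat \<Rightarrow> nat) k (m :: nat \<Rightarrow> nat). filterlim j sequentially sequentially \<and>
    (\<forall>n. k n 0 = g (j n) \<and> k n (m n) = h (j n)) \<and> (\<forall>n i. k n i \<in> carrier G) \<and>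
    (\<forall>n i. dist (\<beta> (k n i) x0) (\<beta> (k n (Suc i)) x0) \<le> R) \<and>
    (\<forall>i. approaches x0 (\<lambda>n. \<beta> (k n (i n)) x0) \<eta>)"
proof -
  obtain c where c: "\<eta> \<in> visual_boundary" "c \<in> \<eta>" "c 0 = x0"
    using g(2) by (auto simp: approaches_def)
  have ev: "eventually (\<lambda>j. r \<le> dist x0 (p j) \<and> dist (geo x0 (p j) r) (c r) \<le> 1) sequentially"
    if p: "approaches x0 p \<eta>" and r: "0 \<le> r" for p r
  proof -
    obtain d where d: "d \<in> \<eta>" "d 0 = x0" "\<And>t. t \<ge> 0 \<Longrightarrow> (\<lambda>n. geo x0 (p n) t) \<longlonglongrightarrow> d t"
      and far: "filterlim (\<lambda>n. dist x0 (p n)) at_top sequentially"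
      using p by (auto simp: approaches_def)
    have "d r = c r" using ray_unique[OF c(1) d(1) c(2) d(2) c(3) r] .
    then have "eventually (\<lambda>j. dist (geo x0 (p j) r) (c r) < 1) sequentially"
      using tendstoD[OF d(3)[OF r], of 1] by simp
    moreover have "eventually (\<lambda>j. r \<le> dist x0 (p j)) sequentially"
      using far by (simp add: filterlim_at_top)
    ultimately show ?thesis by eventually_elim simp
  qed
  have "\<exists>j\<ge>n. real n \<le> dist x0 (\<beta> (g j) x0) \<and> dist (geo x0 (\<beta> (g j) x0) (real n)) (c (real n)) \<le> 1 \<and>
      real n \<le> dist x0 (\<beta> (h j) x0) \<and> dist (geo x0 (\<beta> (h j) x0) (real n)) (c (real n)) \<le> 1" for n
  proof -
    have "eventually (\<lambda>j. j \<ge> n \<and> (real n \<le> dist x0 (\<beta> (g j) x0) \<and> dist (geo x0 (\<beta> (g j) x0) (real n)) (c (real n)) \<le> 1) \<and>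
      real n \<le> dist x0 (\<beta> (h j) x0) \<and> dist (geo x0 (\<beta> (h j) x0) (real n)) (c (real n)) \<le> 1) sequentially"
      by (intro eventually_conj ev[OF g(2)] ev[OF h(2)] eventually_ge_at_top) auto
    from eventually_happens[OF this] show ?thesis by auto
  qed
  then obtain j where j: "\<And>n. j n \<ge> n"
    "\<And>n. real n \<le> dist x0 (\<beta> (g (j n)) x0)" "\<And>n. dist (geo x0 (\<beta> (g (j n)) x0) (real n)) (c (real n)) \<le> 1"
    "\<And>n. real n \<le> dist x0 (\<beta> (h (j n)) x0)" "\<And>n. dist (geo x0 (\<beta> (h (j n)) x0) (real n)) (c (real n)) \<le> 1"
    by metis
  have jlim: "filterlim j sequentially sequentially"
    by (rule filterlim_at_top_mono[OF filterlim_ident]) (use j(1) in auto)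
  let ?p = "\<lambda>n. \<beta> (g (j n)) x0" and ?q = "\<lambda>n. \<beta> (h (j n)) x0"
  have "\<forall>n. \<exists>u m. 0 < m \<and> u 0 = ?p n \<and> u m = ?q n \<and>
    (\<forall>i. dist (u i) (u (Suc i)) \<le> 1 + dist (geo x0 (?p n) (real n)) (geo x0 (?q n) (real n))) \<and>
    (\<forall>i. real n \<le> dist x0 (u i) \<and> (geo x0 (u i) (real n) = geo x0 (?p n) (real n) \<or> geo x0 (u i) (real n) = geo x0 (?q n) (real n)))"
    by (intro allI ex_chain_outside_ball j) auto
  then obtain u m where um: "\<forall>n. 0 < m n \<and> u n 0 = ?p n \<and> u n (m n) = ?q n \<and>
    (\<forall>i. dist (u n i) (u n (Suc i)) \<le> 1 + dist (geo x0 (?p n) (real n)) (geo x0 (?q n) (real n))) \<and>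
    (\<forall>i. real n \<le> dist x0 (u n i) \<and> (geo x0 (u n i) (real n) = geo x0 (?p n) (real n) \<or> geo x0 (u n i) (real n) = geo x0 (?q n) (real n)))"
    unfolding choice_iff by blast
  then have m: "\<And>n. 0 < m n" and u: "\<And>n. u n 0 = ?p n" "\<And>n. u n (m n) = ?q n"
    and step: "\<And>n i. dist (u n i) (u n (Suc i)) \<le> 1 + dist (geo x0 (?p n) (real n)) (geo x0 (?q n) (real n))"
    and far: "\<And>n i. real n \<le> dist x0 (u n i)"
    and alt: "\<And>n i. geo x0 (u n i) (real n) = geo x0 (?p n) (real n) \<or> geo x0 (u n i) (real n) = geo x0 (?q n) (real n)"
    by blast+
  have close: "dist (geo x0 (u n i) (real n)) (c (real n)) \<le> 1" for n i
    using alt[of n i] j(3)[of n] j(5)[of n] by auto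
  have step3: "dist (u n i) (u n (Suc i)) \<le> 3" for n i
    using step[of n i] j(3)[of n] j(5)[of n]
      dist_triangle2[of "geo x0 (?p n) (real n)" "geo x0 (?q n) (real n)" "c (real n)"] by linarith
  have u_lim: "approaches x0 (\<lambda>n. u n (i n)) \<eta>" for i
    by (rule approaches_criterion[OF c filterlim_real_sequentially far close])
  obtain R where R: "R \<ge> 0" "\<And>y. \<exists>g\<in>carrier G. dist (\<beta> g x0) y \<le> R"
    using cobounded_orbit[OF \<beta>] by blast
  have "\<forall>n. \<forall>i. \<exists>k. k \<in> carrier G \<and> dist (\<beta> k x0) (u n i) \<le> R \<and> (i = 0 \<longrightarrow> k = g (j n)) \<and> (i = m n \<longrightarrow> k = h (j n))"
  proof (intro allI)
    fix n i
    consider "i = 0" | "i = m n" "i \<noteq> 0" | "i \<noteq> 0" "i \<noteq> m n" by blast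
    then show "\<exists>k. k \<in> carrier G \<and> dist (\<beta> k x0) (u n i) \<le> R \<and> (i = 0 \<longrightarrow> k = g (j n)) \<and> (i = m n \<longrightarrow> k = h (j n))"
    proof cases
      case 1
      then show ?thesis using R(1) g(1) m[of n] u(1) by (intro exI[of _ "g (j n)"]) auto
    next
      case 2
      then show ?thesis using R(1) h(1) u(2) by (intro exI[of _ "h (j n)"]) auto
    next
      case 3
      then show ?thesis using R(2)[of "u n i"] by blast
    qed
  qed
  then obtain k where "\<forall>n i. k n i \<in> carrier G \<and> dist (\<beta> (k n i) x0) (u n i) \<le> R \<and>
      (i = 0 \<longrightarrow> k n i = g (j n)) \<and> (i = m n \<longrightarrow> k n i = h (j n))"
    unfolding choice_iff by blast
  then have k: "\<And>n i. k n i \<in> carrier G" "\<And>n i. dist (\<beta> (k n i) x0) (u n i) \<le> R"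
    "\<And>n. k n 0 = g (j n)" "\<And>n. k n (m n) = h (j n)" by blast+
  have "dist (\<beta> (k n i) x0) (\<beta> (k n (Suc i)) x0) \<le> 2 * R + 3" for n i
    using k(2)[of n i] k(2)[of n "Suc i"] step3[of n i]
      dist_triangle[of "\<beta> (k n i) x0" "\<beta> (k n (Suc i)) x0" "u n i"]
      dist_triangle2[of "u n i" "\<beta> (k n (Suc i)) x0" "u n (Suc i)"] by linarith
  moreover have "approaches x0 (\<lambda>n. \<beta> (k n (i n)) x0) \<eta>" for i
    by (rule approaches_bounded_perturbation[OF u_lim[of i], of _ R])
      (use k(2) in \<open>simp add: dist_commute\<close>)
  ultimately show ?thesis
    by (intro exI[of _ "2 * R + 3"] exI[of _ j] exI[of _ k] exI[of _ m] conjI allI jlim k)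
qed

end

section \<open>Join coordinates of limits in a product\<close>

text \<open>At time \<open>1\<close> the common path has travelled both \<open>a\<close> and \<open>b\<close>, so the speeds agree.\<close>

lemma ray_speed_unique:
  assumes "geodesic_ray c" "geodesic_ray d" "a > 0" "b > 0" "\<And>t. t \<ge> 0 \<Longrightarrow> c (a * t) = d (b * t)" "0 \<le> t"
  shows "c t = d t"
proof -
  have "dist (c (a * 0)) (c (a * 1)) = a" using assms(1,3) by (simp add: geodesic_ray_def)
  moreover have "dist (d (b * 0)) (d (b * 1)) = b" using assms(2,4) by (simp add: geodesic_ray_def)
  ultimately have "a = b" using assms(5)[of 0] assms(5)[of 1] by simp
  then show ?thesis using assms(5)[of "t / a"] assms(3,6) by simp
qed

text \<open>The ray from the basepoint in a given class is unique, and its coordinate paths determine their unit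
  speed parametrizations.\<close>

lemma join_coords_unique:
  assumes "conical_basepoint x1" "conical_basepoint x2"
    and "join_coords x1 x2 \<xi> \<eta>1 \<eta>2 m" "join_coords x1 x2 \<xi> \<eta>1' \<eta>2' m'"
  shows "\<eta>1 = \<eta>1'" "\<eta>2 = \<eta>2'"
proof -
  interpret conical_basepoint "(x1, x2)" by (rule conical_prod) fact+
  obtain c c1 c2 a b where c: "c \<in> \<xi>" "c1 \<in> \<eta>1" "c2 \<in> \<eta>2" "a > 0" "b > 0" "c 0 = (x1, x2)"
    "\<And>t. t \<ge> 0 \<Longrightarrow> c t = (c1 (a * t), c2 (b * t))"
    and vb: "\<xi> \<in> visual_boundary" "\<eta>1 \<in> visual_boundary" "\<eta>2 \<in> visual_boundary"
    using assms(3) unfolding join_coords_def by blast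
  obtain d d1 d2 a' b' where d: "d \<in> \<xi>" "d1 \<in> \<eta>1'" "d2 \<in> \<eta>2'" "a' > 0" "b' > 0" "d 0 = (x1, x2)"
    "\<And>t. t \<ge> 0 \<Longrightarrow> d t = (d1 (a' * t), d2 (b' * t))"
    and vb': "\<eta>1' \<in> visual_boundary" "\<eta>2' \<in> visual_boundary"
    using assms(4) unfolding join_coords_def by blast
  have "c t = d t" if "t \<ge> 0" for t
    by (rule ray_unique[OF vb(1) c(1) d(1) c(6) d(6) that])
  then have eq: "c1 (a * t) = d1 (a' * t)" "c2 (b * t) = d2 (b' * t)" if "t \<ge> 0" for t
    using c(7)[OF that] d(7)[OF that] that by auto
  note rays = ray_of_boundary[OF vb(2) c(2)] ray_of_boundary[OF vb(3) c(3)]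
    ray_of_boundary[OF vb'(1) d(2)] ray_of_boundary[OF vb'(2) d(3)]
  have "c1 t = d1 t" if "t \<ge> 0" for t
    using ray_speed_unique[of c1 d1 a a' t] rays c(4) d(4) eq(1) that by blast
  then show "\<eta>1 = \<eta>1'" by (rule boundary_eqI[OF vb(2) vb'(1) c(2) d(2)])
  have "c2 t = d2 t" if "t \<ge> 0" for t
    using ray_speed_unique[of c2 d2 b b' t] rays c(5) d(5) eq(2) that by blast
  then show "\<eta>2 = \<eta>2'" by (rule boundary_eqI[OF vb(3) vb'(2) c(3) d(3)])
qed

text \<open>Join coordinates are unique, so the definite descriptions in the schmear maps denote them.\<close>

lemma schmear_map_eq:
  assumes "conical_basepoint x1" "conical_basepoint x2" "join_coords x1 x2 \<xi> \<eta>1 \<eta>2 m"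
  shows "schmear_map1 x1 x2 \<xi> = \<eta>1" "schmear_map2 x1 x2 \<xi> = \<eta>2"
  unfolding schmear_map1_def schmear_map2_def
  by (rule the_equality; use assms join_coords_unique[OF assms(1,2)] in blast)+

lemma geo_prod:
  assumes "conical_basepoint x1" "conical_basepoint x2"
    and "0 < dist (x1, x2) (y1, y2)" "0 \<le> t" "t \<le> dist (x1, x2) (y1, y2)"
  shows "geo (x1, x2) (y1, y2) t =
    (geo x1 y1 (t * (dist x1 y1 / dist (x1, x2) (y1, y2))), geo x2 y2 (t * (dist x2 y2 / dist (x1, x2) (y1, y2))))"
proof -
  interpret A: conical_basepoint x1 by fact
  interpret B: conical_basepoint x2 by fact
  interpret P: conical_basepoint "(x1, x2)" by (rule conical_prod) fact+
  let ?D = "dist (x1, x2) (y1, y2)"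
  let ?p = "geo (x1, x2) (y1, y2) t"
  define l where "l = t / ?D"
  have l: "0 \<le> l" "l \<le> 1" and t: "t = l * ?D" using assms by (auto simp: l_def)
  have "dist (x1, x2) ?p = l * ?D" "dist ?p (y1, y2) = (1 - l) * ?D"
    using assms by (simp_all add: P.dist_geo P.dist_geo_end left_diff_distrib t[symmetric])
  note proj = projections_of_between[OF l this, simplified fst_conv snd_conv]
  have le: "l * d \<le> d" if "0 \<le> d" for d :: real using l that by (simp add: mult_left_le_one_le)
  have "geo x1 y1 (l * dist x1 y1) = fst ?p"
    using proj l le by (intro A.between_unique) (simp_all add: left_diff_distrib)
  moreover have "geo x2 y2 (l * dist x2 y2) = snd ?p"
    using proj l le by (intro B.between_unique) (simp_all add: left_diff_distrib)
  moreover have "t * (d / ?D) = l * d" for d by (simp add: l_def)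
  ultimately show ?thesis by (simp add: prod_eq_iff)
qed

context conical_basepoint
begin

text \<open>In the product, the coordinate of a geodesic to a point at distance \<open>D n\<close> moves at speed
  \<open>dist x0 (q n) / D n\<close>. If these speeds converge to \<open>a > 0\<close>, the coordinate paths have the same limit
  as unit speed geodesics traversed at speed \<open>a\<close>, and this limit path is \<open>e\<close>.\<close>

lemma approaches_reparametrized:
  assumes D: "filterlim D at_top sequentially"
    and a: "a > 0" "(\<lambda>n. dist x0 (q n) / D n) \<longlonglongrightarrow> a"
    and e: "\<And>t. t \<ge> 0 \<Longrightarrow> (\<lambda>n. geo x0 (q n) (t * (dist x0 (q n) / D n))) \<longlonglongrightarrow> e t"
  shows "approaches x0 q (asymptotic_rel `` {\<lambda>s. e (s / a)})" "geodesic_ray (\<lambda>s. e (s / a))"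
proof -
  have "filterlim (\<lambda>n. dist x0 (q n) / D n * D n) at_top sequentially"
    by (rule filterlim_tendsto_pos_mult_at_top[OF a(2,1) D])
  moreover have "eventually (\<lambda>n. dist x0 (q n) / D n * D n = dist x0 (q n)) sequentially"
    using filterlim_at_top_dense[THEN iffD1, OF D, rule_format, of 0] by eventually_elim simp
  ultimately have far: "filterlim (\<lambda>n. dist x0 (q n)) at_top sequentially"
    by (simp cong: filterlim_cong)
  have lim: "(\<lambda>n. geo x0 (q n) s) \<longlonglongrightarrow> e (s / a)" if s: "s \<ge> 0" for s
  proof -
    define t where "t = s / a"
    have t: "t \<ge> 0" "s = t * a" using s a by (auto simp: t_def)
    define \<tau> where "\<tau> n = t * (dist x0 (q n) / D n)" for n
    have pos: "eventually (\<lambda>n. \<tau> n \<ge> 0) sequentially"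
      using filterlim_at_top_dense[THEN iffD1, OF D, rule_format, of 0]
      by eventually_elim (use t in \<open>simp add: \<tau>_def\<close>)
    have "(\<lambda>n. \<bar>s - \<tau> n\<bar>) \<longlonglongrightarrow> \<bar>s - t * a\<bar>"
      unfolding \<tau>_def by (intro tendsto_intros a(2))
    moreover have "(\<lambda>n. dist (geo x0 (q n) (\<tau> n)) (e t)) \<longlonglongrightarrow> 0"
      using e[OF t(1)] unfolding \<tau>_def by (rule tendsto_dist_iff[THEN iffD1])
    ultimately have "(\<lambda>n. \<bar>s - \<tau> n\<bar> + dist (geo x0 (q n) (\<tau> n)) (e t)) \<longlonglongrightarrow> \<bar>s - t * a\<bar> + 0"
      by (rule tendsto_add)
    then have lim0: "(\<lambda>n. \<bar>s - \<tau> n\<bar> + dist (geo x0 (q n) (\<tau> n)) (e t)) \<longlonglongrightarrow> 0" by (simp add: t(2))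
    have "eventually (\<lambda>n. dist (geo x0 (q n) s) (e t) \<le> \<bar>s - \<tau> n\<bar> + dist (geo x0 (q n) (\<tau> n)) (e t)) sequentially"
      using pos
    proof eventually_elim
      case (elim n)
      then show ?case
        using dist_geo_geo_le[OF s elim, of "q n"] dist_triangle[of "geo x0 (q n) s" "e t" "geo x0 (q n) (\<tau> n)"]
        by linarith
    qed
    from tendsto_if_dist_le[OF this lim0] show ?thesis by (simp add: t_def)
  qed
  show "approaches x0 q (asymptotic_rel `` {\<lambda>s. e (s / a)})" using far lim by (rule approachesI)
  show "geodesic_ray (\<lambda>s. e (s / a))" using far lim by (rule geodesic_ray_limit)
qed

end

text \<open>This is why the schmear misses the preferred copies of the boundaries: if each coordinate distance is
  linearly bounded by the other, neither can be negligible in the total distance.\<close>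

lemma limit_ratio_pos:
  fixes d1 d2 D :: "nat \<Rightarrow> real"
  assumes D: "filterlim D at_top sequentially" and le: "\<And>n. D n \<le> d1 n + d2 n"
    and lin: "\<And>n. d2 n \<le> M * (d1 n + 1)" and M: "0 \<le> M" and a: "(\<lambda>n. d1 n / D n) \<longlonglongrightarrow> a"
  shows "0 < a"
proof -
  have "(\<lambda>n. (1 + M) * (d1 n / D n) + M / D n) \<longlonglongrightarrow> (1 + M) * a + 0"
    by (intro tendsto_add tendsto_mult tendsto_const a real_tendsto_divide_at_top[OF tendsto_const D])
  moreover have "eventually (\<lambda>n. 1 \<le> (1 + M) * (d1 n / D n) + M / D n) sequentially"
    using filterlim_at_top_dense[THEN iffD1, OF D, rule_format, of 0]
  proof eventually_elim
    case (elim n)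
    have "D n \<le> (1 + M) * d1 n + M" using le[of n] lin[of n] by (simp add: algebra_simps)
    then have "D n / D n \<le> ((1 + M) * d1 n + M) / D n" using elim by (intro divide_right_mono) auto
    then show ?case using elim by (simp add: add_divide_distrib)
  qed
  ultimately have "1 \<le> (1 + M) * a + 0" by (intro tendsto_lowerbound) auto
  then have "0 < (1 + M) * a" by simp
  then show ?thesis using M by (simp add: zero_less_mult_iff)
qed

text \<open>After passing to a subsequence the speeds of both coordinates converge. Their limits \<open>a\<close> and \<open>b\<close> are
  positive, and \<open>b / a\<close> is the slope of the limit.\<close>

lemma approaches_prod:
  fixes x1 :: "'a::heine_borel" and x2 :: "'b::heine_borel"
  assumes con: "conical_basepoint x1" "conical_basepoint x2"
    and \<xi>: "approaches (x1, x2) (\<lambda>n. (p1 n, p2 n)) \<xi>"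
    and M: "0 \<le> M" "\<And>n. dist x2 (p2 n) \<le> M * (dist x1 (p1 n) + 1)"
    and N: "0 \<le> N" "\<And>n. dist x1 (p1 n) \<le> N * (dist x2 (p2 n) + 1)"
  shows "\<exists>r \<eta>1 \<eta>2 m. strict_mono (r :: nat \<Rightarrow> nat) \<and> join_coords x1 x2 \<xi> \<eta>1 \<eta>2 m \<and>
    approaches x1 (\<lambda>n. p1 (r n)) \<eta>1 \<and> approaches x2 (\<lambda>n. p2 (r n)) \<eta>2"
proof -
  interpret A: conical_basepoint x1 by fact
  interpret B: conical_basepoint x2 by fact
  interpret P: conical_basepoint "(x1, x2)" by (rule conical_prod) fact+
  define D where "D n = dist (x1, x2) (p1 n, p2 n)" for n
  obtain c where c: "\<xi> \<in> visual_boundary" "c \<in> \<xi>" "c 0 = (x1, x2)"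
    "\<And>t. t \<ge> 0 \<Longrightarrow> (\<lambda>n. geo (x1, x2) (p1 n, p2 n) t) \<longlonglongrightarrow> c t"
    and D: "filterlim D at_top sequentially"
    using \<xi> unfolding approaches_def D_def by blast
  have d1D: "dist x1 (p1 n) \<le> D n" and d2D: "dist x2 (p2 n) \<le> D n"
    and Dsum: "D n \<le> dist x1 (p1 n) + dist x2 (p2 n)" for n
    unfolding D_def dist_prod_def by (auto intro: real_le_rsqrt sqrt_sum_squares_le_sum)
  define f where "f n = (dist x1 (p1 n) / D n, dist x2 (p2 n) / D n)" for n
  have "dist x1 (p1 n) / D n \<in> {0..1}" "dist x2 (p2 n) / D n \<in> {0..1}" for n
    using d1D[of n] d2D[of n] order_trans[OF zero_le_dist d1D[of n]] by (auto simp: divide_le_eq_1)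
  then have "range f \<subseteq> {0..1} \<times> {0..1}" unfolding f_def by blast
  moreover have "bounded ({0..1} \<times> {0..1} :: (real \<times> real) set)" by (intro bounded_Times bounded_closed_interval)
  ultimately have "bounded (range f)" by (rule bounded_subset[rotated])
  from bounded_imp_convergent_subsequence[OF this]
  obtain r l where r: "strict_mono (r :: nat \<Rightarrow> nat)" "(\<lambda>n. f (r n)) \<longlonglongrightarrow> l"
    by (auto simp: o_def)
  define a b where "a = fst l" and "b = snd l"
  have a: "(\<lambda>n. dist x1 (p1 (r n)) / D (r n)) \<longlonglongrightarrow> a" and b: "(\<lambda>n. dist x2 (p2 (r n)) / D (r n)) \<longlonglongrightarrow> b"
    using tendsto_fst[OF r(2)] tendsto_snd[OF r(2)] by (simp_all add: f_def a_def b_def)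
  have Dr: "filterlim (\<lambda>n. D (r n)) at_top sequentially"
    by (rule filterlim_compose[OF D filterlim_subseq[OF r(1)]])
  have a0: "0 < a" by (rule limit_ratio_pos[OF Dr Dsum M(2,1) a])
  have b0: "0 < b" by (rule limit_ratio_pos[OF Dr _ N(2,1) b]) (use Dsum in \<open>simp add: add.commute\<close>)
  have "(\<lambda>n. (geo x1 (p1 (r n)) (t * (dist x1 (p1 (r n)) / D (r n))), geo x2 (p2 (r n)) (t * (dist x2 (p2 (r n)) / D (r n))))) \<longlonglongrightarrow> c t"
    if t: "t \<ge> 0" for t
  proof (rule Lim_transform_eventually)
    show "(\<lambda>n. geo (x1, x2) (p1 (r n), p2 (r n)) t) \<longlonglongrightarrow> c t"
      by (rule filterlim_compose[OF c(4)[OF t] filterlim_subseq[OF r(1)]])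
    show "eventually (\<lambda>n. geo (x1, x2) (p1 (r n), p2 (r n)) t =
      (geo x1 (p1 (r n)) (t * (dist x1 (p1 (r n)) / D (r n))), geo x2 (p2 (r n)) (t * (dist x2 (p2 (r n)) / D (r n))))) sequentially"
      using filterlim_at_top_dense[THEN iffD1, OF Dr, rule_format, of t]
    proof eventually_elim
      case (elim n)
      then have "0 < dist (x1, x2) (p1 (r n), p2 (r n))" "t \<le> dist (x1, x2) (p1 (r n), p2 (r n))"
        using t unfolding D_def by linarith+
      then show ?case unfolding D_def by (intro geo_prod con t)
    qed
  qed
  from tendsto_fst[OF this] tendsto_snd[OF this]
  have lim: "(\<lambda>n. geo x1 (p1 (r n)) (t * (dist x1 (p1 (r n)) / D (r n)))) \<longlonglongrightarrow> fst (c t)"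
    "(\<lambda>n. geo x2 (p2 (r n)) (t * (dist x2 (p2 (r n)) / D (r n)))) \<longlonglongrightarrow> snd (c t)" if "t \<ge> 0" for t
    using that by auto
  define c1 c2 where "c1 s = fst (c (s / a))" and "c2 s = snd (c (s / b))" for s
  have 1: "approaches x1 (\<lambda>n. p1 (r n)) (asymptotic_rel `` {c1})" "geodesic_ray c1"
    unfolding c1_def by (rule A.approaches_reparametrized[OF Dr a0 a lim(1)]; assumption)+
  have 2: "approaches x2 (\<lambda>n. p2 (r n)) (asymptotic_rel `` {c2})" "geodesic_ray c2"
    unfolding c2_def by (rule B.approaches_reparametrized[OF Dr b0 b lim(2)]; assumption)+
  have "c t = (c1 (a * t), c2 (b * t))" for t using a0 b0 by (simp add: c1_def c2_def)
  then have "join_coords x1 x2 \<xi> (asymptotic_rel `` {c1}) (asymptotic_rel `` {c2}) (b / a)"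
    unfolding join_coords_def using c(1-3) a0 b0 boundary_class[OF 1(2)] boundary_class[OF 2(2)] by blast
  then show ?thesis using r(1) 1(1) 2(1) by blast
qed

section \<open>Connectedness of the fibers\<close>

text \<open>The part of the proof common to both coordinates. The space with basepoint \<open>y0\<close> plays the role of the
  factor and \<open>orb\<close> that of the diagonal orbit map. The hypotheses make \<open>S\<close> the set of
  subsequential limits of \<open>orb\<close> along sequences whose orbit points in the factor approach \<open>\<eta>\<close>.
  Chains of group elements near \<open>\<eta>\<close> then become chains in the product whose limits all lie in \<open>S\<close>.\<close>

lemma connectedin_fiber:
  fixes w0 :: "'c::heine_borel" and y0 :: "'b::heine_borel" and orb :: "'g \<Rightarrow> 'c"
  assumes w0: "conical_basepoint w0" and y0: "conical_basepoint y0" and \<beta>: "geometric_action G \<beta>"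
    and coarse: "\<And>R. \<exists>M. \<forall>g\<in>carrier G. \<forall>h\<in>carrier G. dist (\<beta> g y0) (\<beta> h y0) \<le> R \<longrightarrow> dist (orb g) (orb h) \<le> M"
    and lift: "\<And>\<xi>. \<xi> \<in> S \<Longrightarrow> \<exists>g. (\<forall>n. g n \<in> carrier G) \<and> approaches w0 (\<lambda>n. orb (g n)) \<xi> \<and> approaches y0 (\<lambda>n. \<beta> (g n) y0) \<eta>"
    and sub: "\<And>g. (\<And>n. g n \<in> carrier G) \<Longrightarrow> approaches y0 (\<lambda>n. \<beta> (g n) y0) \<eta> \<Longrightarrow>
      \<exists>r. \<exists>\<xi>\<in>S. strict_mono (r :: nat \<Rightarrow> nat) \<and> approaches w0 (\<lambda>n. orb (g (r n))) \<xi>"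
  shows "connectedin (boundary_topology w0) S"
proof (rule conical_basepoint.connectedin_if_chains[OF w0])
  fix \<xi> assume "\<xi> \<in> S"
  then show "\<xi> \<in> visual_boundary \<and> (\<exists>c\<in>\<xi>. c 0 = w0)"
    using lift by (fastforce simp: approaches_def)
next
  fix \<xi> \<zeta> assume "\<xi> \<in> S" "\<zeta> \<in> S"
  obtain g where g: "\<And>n. g n \<in> carrier G" "approaches w0 (\<lambda>n. orb (g n)) \<xi>" "approaches y0 (\<lambda>n. \<beta> (g n) y0) \<eta>"
    using lift[OF \<open>\<xi> \<in> S\<close>] by blast
  obtain h where h: "\<And>n. h n \<in> carrier G" "approaches w0 (\<lambda>n. orb (h n)) \<zeta>" "approaches y0 (\<lambda>n. \<beta> (h n) y0) \<eta>"
    using lift[OF \<open>\<zeta> \<in> S\<close>] by blast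
  obtain R j k m where j: "filterlim j sequentially sequentially"
    and ends: "\<And>n. k n 0 = g (j n)" "\<And>n. k n (m n) = h (j n)" and kG: "\<And>n i. k n i \<in> carrier G"
    and step: "\<And>n i. dist (\<beta> (k n i) y0) (\<beta> (k n (Suc i)) y0) \<le> R"
    and lim: "\<And>i. approaches y0 (\<lambda>n. \<beta> (k n (i n)) y0) \<eta>"
    using conical_basepoint.ex_group_chains[OF y0 \<beta> g(1,3) h(1,3)] by blast
  obtain M where M: "\<And>g h. g \<in> carrier G \<Longrightarrow> h \<in> carrier G \<Longrightarrow> dist (\<beta> g y0) (\<beta> h y0) \<le> R \<Longrightarrow> dist (orb g) (orb h) \<le> M"
    using coarse by blast
  show "\<exists>D k m. approaches w0 (\<lambda>n. k n 0) \<xi> \<and> approaches w0 (\<lambda>n. k n (m n)) \<zeta> \<and>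
      (\<forall>n. \<forall>i<m n. dist (k n i) (k n (Suc i)) \<le> D) \<and>
      (\<forall>i. (\<forall>n. i n \<le> m n) \<longrightarrow> (\<exists>r. \<exists>\<omega>\<in>S. strict_mono r \<and> approaches w0 (\<lambda>n. k (r n) (i (r n))) \<omega>))"
  proof (rule exI[of _ M], rule exI[of _ "\<lambda>n i. orb (k n i)"], rule exI[of _ m], intro conjI allI impI)
    show "approaches w0 (\<lambda>n. orb (k n 0)) \<xi>" "approaches w0 (\<lambda>n. orb (k n (m n))) \<zeta>"
      using approaches_subseq[OF g(2) j] approaches_subseq[OF h(2) j] by (simp_all add: ends)
    show "dist (orb (k n i)) (orb (k n (Suc i))) \<le> M" for n i
      by (rule M[OF kG kG step])
    show "\<exists>r. \<exists>\<omega>\<in>S. strict_mono r \<and> approaches w0 (\<lambda>n. orb (k (r n) (i (r n)))) \<omega>" for i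
      by (rule sub[of "\<lambda>n. k n (i n)", OF kG lim])
  qed
qed

theorem theorem4:
  fixes G :: "('g, 'm) monoid_scheme"
    and \<alpha>1 :: "'g \<Rightarrow> 'a::heine_borel \<Rightarrow> 'a" and \<alpha>2 :: "'g \<Rightarrow> 'b::heine_borel \<Rightarrow> 'b"
    and x1 :: 'a and x2 :: 'b
  assumes "CAT0 TYPE('a)" and "CAT0 TYPE('b)"
    and "geometric_action G \<alpha>1" and "geometric_action G \<alpha>2"
  shows "(\<forall>\<eta>\<in>visual_boundary. connectedin (boundary_topology (x1, x2))
            {\<xi> \<in> schmear G \<alpha>1 \<alpha>2 x1 x2. schmear_map1 x1 x2 \<xi> = \<eta>}) \<and>
         (\<forall>\<eta>\<in>visual_boundary. connectedin (boundary_topology (x1, x2))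
            {\<xi> \<in> schmear G \<alpha>1 \<alpha>2 x1 x2. schmear_map2 x1 x2 \<xi> = \<eta>})"
proof -
  note con = CAT0_imp_conical[OF assms(1), of x1] CAT0_imp_conical[OF assms(2), of x2]
  note act = assms(3,4)
  interpret A: conical_basepoint x1 by (rule con)
  interpret B: conical_basepoint x2 by (rule con)
  interpret P: conical_basepoint "(x1, x2)" by (rule conical_prod[OF con])
  define orb where "orb g = (\<alpha>1 g x1, \<alpha>2 g x2)" for g
  have schmear_iff: "\<xi> \<in> schmear G \<alpha>1 \<alpha>2 x1 x2 \<longleftrightarrow>
      (\<exists>g. (\<forall>n. g n \<in> carrier G) \<and> approaches (x1, x2) (\<lambda>n. orb (g n)) \<xi>)" for \<xi>
  proof
    assume "\<xi> \<in> schmear G \<alpha>1 \<alpha>2 x1 x2"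
    then obtain p where p: "\<forall>n. \<exists>g. g \<in> carrier G \<and> p n = orb g" "approaches (x1, x2) p \<xi>"
      unfolding schmear_def P.boundary_limit_points_iff orbit_def orb_def by fastforce
    from p(1) obtain g where "\<forall>n. g n \<in> carrier G \<and> p n = orb (g n)" unfolding choice_iff by blast
    moreover from this have "p = (\<lambda>n. orb (g n))" by auto
    ultimately show "\<exists>g. (\<forall>n. g n \<in> carrier G) \<and> approaches (x1, x2) (\<lambda>n. orb (g n)) \<xi>" using p(2) by blast
  next
    assume "\<exists>g. (\<forall>n. g n \<in> carrier G) \<and> approaches (x1, x2) (\<lambda>n. orb (g n)) \<xi>"
    then obtain g where "\<And>n. g n \<in> carrier G" "approaches (x1, x2) (\<lambda>n. orb (g n)) \<xi>" by blast
    then show "\<xi> \<in> schmear G \<alpha>1 \<alpha>2 x1 x2"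
      unfolding schmear_def P.boundary_limit_points_iff orbit_def orb_def
      by (intro exI[of _ "\<lambda>n. (\<alpha>1 (g n) x1, \<alpha>2 (g n) x2)"]) auto
  qed
  obtain M where M: "M \<ge> 0" "\<And>g. g \<in> carrier G \<Longrightarrow> dist x2 (\<alpha>2 g x2) \<le> M * (dist x1 (\<alpha>1 g x1) + 1)"
    using A.orbit_map_linear_bound[OF act, of x2] by blast
  obtain N where N: "N \<ge> 0" "\<And>g. g \<in> carrier G \<Longrightarrow> dist x1 (\<alpha>1 g x1) \<le> N * (dist x2 (\<alpha>2 g x2) + 1)"
    using B.orbit_map_linear_bound[OF act(2,1), of x1] by blast
  \<comment> \<open>limits of the diagonal orbit determine the limits of its coordinates\<close>
  have coords: "\<exists>r \<eta>1 \<eta>2 m. strict_mono (r :: nat \<Rightarrow> nat) \<and> join_coords x1 x2 \<xi> \<eta>1 \<eta>2 m \<and>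
      approaches x1 (\<lambda>n. \<alpha>1 (g (r n)) x1) \<eta>1 \<and> approaches x2 (\<lambda>n. \<alpha>2 (g (r n)) x2) \<eta>2"
    if "\<And>n. g n \<in> carrier G" "approaches (x1, x2) (\<lambda>n. orb (g n)) \<xi>" for g \<xi>
    using that by (intro approaches_prod[OF con _ M(1) _ N(1)] M(2) N(2)) (simp_all add: orb_def)
  have lift: "\<exists>g. (\<forall>n. g n \<in> carrier G) \<and> approaches (x1, x2) (\<lambda>n. orb (g n)) \<xi> \<and>
      approaches x1 (\<lambda>n. \<alpha>1 (g n) x1) (schmear_map1 x1 x2 \<xi>) \<and>
      approaches x2 (\<lambda>n. \<alpha>2 (g n) x2) (schmear_map2 x1 x2 \<xi>)"
    if \<xi>: "\<xi> \<in> schmear G \<alpha>1 \<alpha>2 x1 x2" for \<xi>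
  proof -
    obtain g where g: "\<And>n. g n \<in> carrier G" "approaches (x1, x2) (\<lambda>n. orb (g n)) \<xi>"
      using \<xi> schmear_iff by blast
    obtain r \<eta>1 \<eta>2 m where r: "strict_mono (r :: nat \<Rightarrow> nat)" "join_coords x1 x2 \<xi> \<eta>1 \<eta>2 m"
      "approaches x1 (\<lambda>n. \<alpha>1 (g (r n)) x1) \<eta>1" "approaches x2 (\<lambda>n. \<alpha>2 (g (r n)) x2) \<eta>2"
      using coords[OF g] by blast
    then show ?thesis
      using g(1) approaches_subseq[OF g(2) filterlim_subseq[OF r(1)]] schmear_map_eq[OF con r(2)]
      by (intro exI[of _ "\<lambda>n. g (r n)"]) auto
  qed
  \<comment> \<open>compactness of the boundary: every divergent sequence in the diagonal orbit has a limit in the schmear\<close>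
  have sub: "\<exists>r \<xi>. strict_mono (r :: nat \<Rightarrow> nat) \<and> \<xi> \<in> schmear G \<alpha>1 \<alpha>2 x1 x2 \<and>
      approaches (x1, x2) (\<lambda>n. orb (g (r n))) \<xi> \<and>
      approaches x1 (\<lambda>n. \<alpha>1 (g (r n)) x1) (schmear_map1 x1 x2 \<xi>) \<and>
      approaches x2 (\<lambda>n. \<alpha>2 (g (r n)) x2) (schmear_map2 x1 x2 \<xi>)"
    if g: "\<And>n. g n \<in> carrier G" "filterlim (\<lambda>n. dist (x1, x2) (orb (g n))) at_top sequentially" for g
  proof -
    obtain r \<xi> where r: "strict_mono (r :: nat \<Rightarrow> nat)" "approaches (x1, x2) (\<lambda>n. orb (g (r n))) \<xi>"
      using P.ex_approaching_subsequence[OF g(2)] by blast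
    obtain s \<eta>1 \<eta>2 m where s: "strict_mono (s :: nat \<Rightarrow> nat)" "join_coords x1 x2 \<xi> \<eta>1 \<eta>2 m"
      "approaches x1 (\<lambda>n. \<alpha>1 (g (r (s n))) x1) \<eta>1" "approaches x2 (\<lambda>n. \<alpha>2 (g (r (s n))) x2) \<eta>2"
      using coords[of "\<lambda>n. g (r n)" \<xi>, OF g(1) r(2)] by blast
    have "\<xi> \<in> schmear G \<alpha>1 \<alpha>2 x1 x2"
      unfolding schmear_iff using g(1) r(2) by (intro exI[of _ "\<lambda>n. g (r n)"] conjI allI)
    moreover have "strict_mono (\<lambda>n. r (s n))"
      using strict_mono_o[OF r(1) s(1)] by (simp add: o_def)
    ultimately show ?thesis
      using s(3,4) schmear_map_eq[OF con s(2)] approaches_subseq[OF r(2) filterlim_subseq[OF s(1)]]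
      by (intro exI[of _ "\<lambda>n. r (s n)"] exI[of _ \<xi>]) simp
  qed
  have far: "filterlim (\<lambda>n. dist (x1, x2) (orb (g n))) at_top sequentially"
    if "filterlim (\<lambda>n. dist x1 (\<alpha>1 (g n) x1)) at_top sequentially \<or> filterlim (\<lambda>n. dist x2 (\<alpha>2 (g n) x2)) at_top sequentially" for g
    using that
  proof
    assume "filterlim (\<lambda>n. dist x1 (\<alpha>1 (g n) x1)) at_top sequentially"
    then show ?thesis
      by (rule filterlim_at_top_mono) (use dist_fst_le[of "(x1, x2)" "orb (g _)"] in \<open>simp add: orb_def\<close>)
  next
    assume "filterlim (\<lambda>n. dist x2 (\<alpha>2 (g n) x2)) at_top sequentially"
    then show ?thesis
      by (rule filterlim_at_top_mono) (use dist_snd_le[of "(x1, x2)" "orb (g _)"] in \<open>simp add: orb_def\<close>)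
  qed
  have orb_le: "dist (orb g) (orb h) \<le> dist (\<alpha>1 g x1) (\<alpha>1 h x1) + dist (\<alpha>2 g x2) (\<alpha>2 h x2)" for g h
    by (simp add: orb_def dist_prod_def sqrt_sum_squares_le_sum)
  have coarse1: "\<exists>M. \<forall>g\<in>carrier G. \<forall>h\<in>carrier G. dist (\<alpha>1 g x1) (\<alpha>1 h x1) \<le> R \<longrightarrow> dist (orb g) (orb h) \<le> M" for R
  proof -
    obtain L where "\<And>g h. g \<in> carrier G \<Longrightarrow> h \<in> carrier G \<Longrightarrow> dist (\<alpha>1 g x1) (\<alpha>1 h x1) \<le> R \<Longrightarrow> dist (\<alpha>2 g x2) (\<alpha>2 h x2) \<le> L"
      using orbit_map_coarse[OF act, of x1 R x2] by blast
    then show ?thesis by (intro exI[of _ "R + L"]) (meson orb_le add_mono order_trans)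
  qed
  have coarse2: "\<exists>M. \<forall>g\<in>carrier G. \<forall>h\<in>carrier G. dist (\<alpha>2 g x2) (\<alpha>2 h x2) \<le> R \<longrightarrow> dist (orb g) (orb h) \<le> M" for R
  proof -
    obtain L where "\<And>g h. g \<in> carrier G \<Longrightarrow> h \<in> carrier G \<Longrightarrow> dist (\<alpha>2 g x2) (\<alpha>2 h x2) \<le> R \<Longrightarrow> dist (\<alpha>1 g x1) (\<alpha>1 h x1) \<le> L"
      using orbit_map_coarse[OF act(2,1), of x2 R x1] by blast
    then show ?thesis by (intro exI[of _ "L + R"]) (meson orb_le add_mono order_trans)
  qed
  have "connectedin (boundary_topology (x1, x2)) {\<xi> \<in> schmear G \<alpha>1 \<alpha>2 x1 x2. schmear_map1 x1 x2 \<xi> = \<eta>}" for \<eta>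
  proof (rule connectedin_fiber[OF P.conical_basepoint_axioms con(1) act(1) coarse1])
    fix g assume g: "\<And>n. g n \<in> carrier G" and lim: "approaches x1 (\<lambda>n. \<alpha>1 (g n) x1) \<eta>"
    then have "filterlim (\<lambda>n. dist x1 (\<alpha>1 (g n) x1)) at_top sequentially" by (simp add: approaches_def)
    then obtain r \<xi> where r: "strict_mono r" "\<xi> \<in> schmear G \<alpha>1 \<alpha>2 x1 x2"
      "approaches (x1, x2) (\<lambda>n. orb (g (r n))) \<xi>" "approaches x1 (\<lambda>n. \<alpha>1 (g (r n)) x1) (schmear_map1 x1 x2 \<xi>)"
      using sub[of g, OF g far] by blast
    have "schmear_map1 x1 x2 \<xi> = \<eta>"
      by (rule A.approaches_unique[OF r(4) approaches_subseq[OF lim filterlim_subseq[OF r(1)]]])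
    then show "\<exists>r. \<exists>\<xi>\<in>{\<xi> \<in> schmear G \<alpha>1 \<alpha>2 x1 x2. schmear_map1 x1 x2 \<xi> = \<eta>}.
        strict_mono r \<and> approaches (x1, x2) (\<lambda>n. orb (g (r n))) \<xi>" using r by blast
  qed (use lift in blast)
  moreover have "connectedin (boundary_topology (x1, x2)) {\<xi> \<in> schmear G \<alpha>1 \<alpha>2 x1 x2. schmear_map2 x1 x2 \<xi> = \<eta>}" for \<eta>
  proof (rule connectedin_fiber[OF P.conical_basepoint_axioms con(2) act(2) coarse2])
    fix g assume g: "\<And>n. g n \<in> carrier G" and lim: "approaches x2 (\<lambda>n. \<alpha>2 (g n) x2) \<eta>"
    then have "filterlim (\<lambda>n. dist x2 (\<alpha>2 (g n) x2)) at_top sequentially" by (simp add: approaches_def)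
    then obtain r \<xi> where r: "strict_mono r" "\<xi> \<in> schmear G \<alpha>1 \<alpha>2 x1 x2"
      "approaches (x1, x2) (\<lambda>n. orb (g (r n))) \<xi>" "approaches x2 (\<lambda>n. \<alpha>2 (g (r n)) x2) (schmear_map2 x1 x2 \<xi>)"
      using sub[of g, OF g far] by blast
    have "schmear_map2 x1 x2 \<xi> = \<eta>"
      by (rule B.approaches_unique[OF r(4) approaches_subseq[OF lim filterlim_subseq[OF r(1)]]])
    then show "\<exists>r. \<exists>\<xi>\<in>{\<xi> \<in> schmear G \<alpha>1 \<alpha>2 x1 x2. schmear_map2 x1 x2 \<xi> = \<eta>}.
        strict_mono r \<and> approaches (x1, x2) (\<lambda>n. orb (g (r n))) \<xi>" using r by blast
  qed (use lift in blast)
  ultimately show ?thesis by blast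
qed

end
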